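(* (1) Let $C_6>0$ be a constant such that for every sufficiently large integer $n$ there exists a positive integer $m\le n$ with $\log K(m)\ge \rho\log n-C_6\frac{(\log n)^{1/\rho}}{\log\log n}\ge \rho\log m-C_6\frac{(\log m)^{1/\rho}}{\log\log m}$. Then every sufficiently large $K$-champion number $N$ satisfies $$\log K(N)\ge\rho\log N-C_6\,\frac{(\log N)^{1/\rho}}{\log\log N}.$$ (2) There exist three positive constants $C_7,C_8,N_0$ such that for every $K$-champion number $N\ge N_0$, $$C_7\,\frac{(\log N)^{1/\rho}}{\log\log N}\le\omega(N)\le C_8\,\frac{(\log N)^{1/\rho}}{\log\log N}.$$
   Context: $K$ is the Kalmár function: $K(1)=1$ and, for $n\ge 2$, $K(n)$ is the number of ordered factorizations $n=x_1x_2\cdots x_r$ ($r\ge1$ arbitrary) into integers $x_i\ge 2$. A positive integer $N$ is a $K$-champion if $K(M)<K(N)$ for every positive integer $M<N$. $\omega(N)$ is the number of distinct prime factors of $N$. $\rho=1.7286\ldots$ is the unique real number $>1$ with $\zeta(\rho)=2$, where $\zeta$ is the Riemann zeta function. A constant $C_6$ with the property required in (1) exists (it is given by the paper's theorem on large values of $K$). *)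

theory Defs
  imports Complex_Main "HOL-Computational_Algebra.Primes"
begin

definition ordered_factorizations :: "nat \<Rightarrow> nat list set" where
  "ordered_factorizations n = {xs. xs \<noteq> [] \<and> (\<forall>x\<in>set xs. 2 \<le> x) \<and> prod_list xs = n}"

(* Only arguments n \<ge> 1 are meaningful; the definition gives K 0 = 0. *)
definition kalmar_K :: "nat \<Rightarrow> nat" where
  "kalmar_K n = (if n = 1 then 1 else card (ordered_factorizations n))"

definition K_champion :: "nat \<Rightarrow> bool" where
  "K_champion N \<longleftrightarrow> 0 < N \<and> (\<forall>M. 0 < M \<and> M < N \<longrightarrow> kalmar_K M < kalmar_K N)"

definition omega :: "nat \<Rightarrow> nat" where
  "omega n = card (prime_factors n)"

(* The Dirichlet series of the Riemann zeta function; used only for s > 1, where it converges. *)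
definition real_zeta :: "real \<Rightarrow> real" where
  "real_zeta s = (\<Sum>n. 1 / real (Suc n) powr s)"

definition rho :: real where
  "rho = (THE s. 1 < s \<and> real_zeta s = 2)"

end

theory Submission
  imports Defs "HOL-Analysis.Analysis" "HOL-Real_Asymp.Real_Asymp"
begin


text \<open>
  Give each integer \<open>x \<ge> 2\<close> the probability \<open>x\<^sup>-\<^sup>\<rho>\<close>; these add up to 1 because \<open>\<zeta>(\<rho>) = 2\<close>. A word
  of independent random letters has probability \<open>n\<^sup>-\<^sup>\<rho>\<close>, where \<open>n\<close> is the product of its letters, so
  for \<open>n \<ge> 2\<close> the number \<open>K(n) n\<^sup>-\<^sup>\<rho>\<close> is the sum over all lengths \<open>r\<close> of the probability that a word
  of length \<open>r\<close> has product \<open>n\<close>. The recursion \<open>K(n) = \<Sum> K(n/d)\<close>, over the divisors \<open>d \<ge> 2\<close>, yields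
  \<open>K(n) \<le> n\<^sup>\<rho>\<close>. The bounds on \<open>\<omega>(N)\<close> come from measuring how much is lost in this inequality. Put
  \<open>L = ln N\<close>, \<open>Y = L powr (1/\<rho>)\<close> and \<open>R = Y / ln L\<close>; everything happens on the scale \<open>R\<close>.

  A champion loses only \<open>O(R)\<close> (\<open>K_champion_large\<close>): its value is at least \<open>K(m)\<close> for every
  \<open>m \<le> N\<close>, and some such \<open>m\<close> has \<open>ln K(m) \<ge> \<rho> L - O(R)\<close> (\<open>large_values\<close>). To find \<open>m\<close>, draw about
  \<open>L / \<mu>\<close> letters from the integers up to \<open>Y\<^sup>2\<close> without prime factor above \<open>Y\<close>, where \<open>\<mu>\<close> is the mean
  of the logarithm of a letter. Discarding the other integers costs \<open>O(R)\<close>, since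
  \<open>\<Sum>\<^sub>p\<^sub>>\<^sub>Y p\<^sup>-\<^sup>\<rho> = O(Y powr (1-\<rho>) / ln Y)\<close> by Chebyshev. With probability at least \<open>1/2\<close> the logarithm of
  the product is within \<open>O(\<surd>L)\<close> of its mean, which is negligible against \<open>R\<close> because \<open>\<rho> < 2\<close>, and the
  exponents of the primes \<open>p \<le> Y\<close> deviate from their means by \<open>O(1)\<close> standard deviations on average
  over \<open>p\<close> (\<open>large_value_in_typical_set\<close>). The standard deviation at \<open>p\<close> has order at most
  \<open>(Y/p) powr (\<rho>/2)\<close>, so the typical products number at most
  \<open>exp (O (\<Sum>\<^sub>p\<^sub>\<le>\<^sub>Y (1 + ln (Y/p)))) = exp (O(R))\<close>, and one of them is hit with probability
  \<open>exp (-O(R))\<close>. Counting the products by their prime exponents is what gains the factor \<open>ln L\<close>: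
  fixing instead how often each single letter occurs would cost a factor \<open>exp (c Y)\<close>.

  Conversely, the wrong number of prime divisors costs more than \<open>O(R)\<close>. If \<open>\<omega>(N)\<close> is below a small
  multiple of \<open>R\<close>, many primes up to \<open>a Y\<close> do not divide \<open>N\<close>, for a small constant \<open>a\<close>. The divisors
  \<open>d \<ge> 2\<close> of \<open>N\<close> then have total probability at most \<open>1 - c a powr (1-\<rho>) R / L\<close>, which allows a
  smaller exponent in \<open>K(N) \<le> N\<^sup>\<rho>\<close> and saves a constant times \<open>a powr (1-\<rho>) R\<close>
  (\<open>ln_kalmar_K_le_of_missing_primes\<close>); for \<open>a\<close> small this exceeds the loss of a champion. For the
  upper bound each prime divisor above \<open>Y\<close> doubles the weight of a letter: the probabilities still
  sum to at most 1 after raising \<open>\<rho>\<close> by \<open>O(R / L)\<close>, while every such prime divisor of \<open>N\<close> lowers the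
  bound for \<open>ln K(N)\<close> by \<open>ln 2\<close> (\<open>ln_kalmar_K_le_of_prime_divisors\<close>), so there are \<open>O(R)\<close> of them. At
  most \<open>O(R)\<close> primes lie below \<open>Y\<close>.
\<close>

section \<open>The zeta function and the number \<open>\<rho>\<close>\<close>

lemma powr_telescope_bound:
  fixes s :: real
  assumes "s > 1" and "n \<ge> 1"
  shows "real (Suc n) powr -s \<le> (real n powr (1-s) - real (Suc n) powr (1-s)) / (s-1)"
proof -
  have "\<exists>z. real n < z \<and> z < real (Suc n) \<and>
      real (Suc n) powr (1-s) - real n powr (1-s) = (real (Suc n) - real n) * ((1-s) * z powr (1-s-1))"
    by (rule MVT2) (use assms in \<open>auto intro!: derivative_eq_intros simp: field_simps\<close>)
  then obtain z where z: "real n < z" "z < real (Suc n)"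
     "real (Suc n) powr (1-s) - real n powr (1-s) = (1-s) * z powr (-s)"
    by auto
  have "real (Suc n) powr -s \<le> z powr -s"
    using z assms by (intro powr_mono2') auto
  also have "\<dots> = (real n powr (1-s) - real (Suc n) powr (1-s)) / (s-1)"
    using z(3) assms(1) by (simp add: field_simps)
  finally show ?thesis .
qed

lemma powr_tail_telescope:
  fixes s :: real
  assumes "s > 1" and "y \<ge> 1" and "y \<le> M"
  shows "(\<Sum>n\<in>{y<..M}. real n powr -s) \<le> (real y powr (1-s) - real M powr (1-s)) / (s-1)"
  using assms(3)
proof (induction M rule: dec_induct)
  case (step m)
  have "{y<..Suc m} = insert (Suc m) {y<..m}" using step by auto
  hence "(\<Sum>n\<in>{y<..Suc m}. real n powr -s) = real (Suc m) powr -s + (\<Sum>n\<in>{y<..m}. real n powr -s)"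
    by simp
  also have "\<dots> \<le> (real m powr (1-s) - real (Suc m) powr (1-s)) / (s-1)
      + (real y powr (1-s) - real m powr (1-s)) / (s-1)"
    using powr_telescope_bound[of s m] step assms by (intro add_mono) auto
  also have "\<dots> = (real y powr (1-s) - real (Suc m) powr (1-s)) / (s-1)"
    by (simp add: diff_divide_distrib)
  finally show ?case .
qed auto

lemma powr_tail:
  fixes s :: real
  assumes "s > 1" and "y \<ge> 1"
  shows "(\<Sum>n\<in>{y<..M}. real n powr -s) \<le> real y powr (1-s) / (s-1)"
proof (cases "y \<le> M")
  case True
  have "(real y powr (1-s) - real M powr (1-s)) / (s-1) \<le> real y powr (1-s) / (s-1)"
    using assms by (intro divide_right_mono) auto
  thus ?thesis using powr_tail_telescope[OF assms True] by linarith
qed (use assms in auto)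

lemma real_zeta_summable:
  assumes "s > 1"
  shows "summable (\<lambda>n. real (Suc n) powr -s)"
  using summable_real_powr_iff[of "-s"] assms summable_Suc_iff[of "\<lambda>n. real n powr -s"] by simp

lemma real_zeta_alt: "real_zeta s = (\<Sum>n. real (Suc n) powr -s)"
  by (simp add: real_zeta_def powr_minus_divide)

lemma real_zeta_strict_antimono:
  assumes "1 < s" "s < t"
  shows "real_zeta t < real_zeta s"
  unfolding real_zeta_alt
proof -
  have "0 < (\<Sum>n. real (Suc n) powr -s - real (Suc n) powr -t)"
    using assms by (intro suminf_pos2[of _ 1] summable_diff real_zeta_summable)
       (auto intro!: powr_mono simp del: of_nat_Suc)
  thus "(\<Sum>n. real (Suc n) powr -t) < (\<Sum>n. real (Suc n) powr -s)"
    using assms by (subst (asm) suminf_diff[symmetric]) (auto intro!: real_zeta_summable simp del: of_nat_Suc)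
qed

lemma continuous_on_real_zeta:
  assumes "a > 1"
  shows "continuous_on {a..} real_zeta"
proof -
  have "uniform_limit {a..} (\<lambda>n s. \<Sum>i<n. real (Suc i) powr -s)
          (\<lambda>s. \<Sum>i. real (Suc i) powr -s) sequentially"
    by (rule Weierstrass_m_test[OF _ real_zeta_summable[OF assms]]) (auto intro!: powr_mono simp del: of_nat_Suc)
  moreover have "\<forall>\<^sub>F n in sequentially. continuous_on {a..} (\<lambda>s. \<Sum>i<n. real (Suc i) powr -s)"
    by (intro always_eventually allI continuous_intros) auto
  ultimately have "continuous_on {a..} (\<lambda>s. \<Sum>i. real (Suc i) powr -s)"
    by (intro uniform_limit_theorem) auto
  thus ?thesis by (simp add: real_zeta_alt[abs_def])
qed

lemma real_zeta_2_less: "real_zeta 2 < 2"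
proof -
  have *: "(\<Sum>n<N. real (Suc n) powr -2) \<le> 1 + 1/4 + 1/2" for N
  proof -
    have "(\<Sum>n<N. real (Suc n) powr -2) = (\<Sum>n\<in>{0<..N}. real n powr -2)"
      by (rule sum.reindex_bij_witness[of _ "\<lambda>n. n - 1" Suc]) auto
    also have "\<dots> \<le> (\<Sum>n\<in>insert 1 (insert 2 {2<..N}). real n powr -2)"
      by (intro sum_mono2) auto
    also have "\<dots> = 1 + 1/4 + (\<Sum>n\<in>{2<..N}. real n powr -2)"
      by (simp add: powr_minus)
    also have "(\<Sum>n\<in>{2<..N}. real n powr -2) \<le> 1/2"
      using powr_tail[of 2 2 N] by (simp add: powr_minus)
    finally show ?thesis by simp
  qed
  have "real_zeta 2 \<le> 1 + 1/4 + 1/2"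
    unfolding real_zeta_alt
    by (intro suminf_le_const real_zeta_summable *) auto
  thus ?thesis by simp
qed

text \<open>
  At \<open>s = 1\<close> the partial sum \<open>1 + 1/2 + 1/3 + 1/4\<close> already exceeds 2, and a finite sum is continuous
  in \<open>s\<close>.
\<close>
lemma real_zeta_near_1: "\<exists>s. 1 < s \<and> s < 2 \<and> 2 < real_zeta s"
proof -
  have "((\<lambda>s. \<Sum>i<4. real (Suc i) powr -s) \<longlongrightarrow> (\<Sum>i<4. real (Suc i) powr -1)) (at_right 1)"
    by (intro tendsto_intros) auto
  moreover have "(\<Sum>i<4. real (Suc i) powr -1) > 2"
    by (simp add: eval_nat_numeral powr_minus)
  ultimately have "\<forall>\<^sub>F s in at_right 1. (\<Sum>i<4. real (Suc i) powr -s) > 2"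
    by (rule order_tendstoD)
  moreover have "\<forall>\<^sub>F s :: real in at_right 1. s \<in> {1<..<2}"
    by (rule eventually_at_right_real) simp
  ultimately have "\<forall>\<^sub>F s in at_right 1. (\<Sum>i<4. real (Suc i) powr -s) > 2 \<and> s \<in> {1<..<2::real}"
    by (rule eventually_conj)
  then obtain s where s: "(\<Sum>i<4. real (Suc i) powr -s) > 2" "1 < s" "s < 2"
    using eventually_happens[of _ "at_right (1::real)"] by auto
  have "(\<Sum>i<4. real (Suc i) powr -s) \<le> real_zeta s"
    unfolding real_zeta_alt by (intro sum_le_suminf real_zeta_summable s) auto
  thus ?thesis using s by (intro exI[of _ s]) auto
qed

lemma rho_props: "1 < rho" "rho < 2" "real_zeta rho = 2"
proof -
  obtain a where a: "1 < a" "a < 2" "2 < real_zeta a" using real_zeta_near_1 by blast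
  have "\<exists>s\<ge>a. s \<le> 2 \<and> real_zeta s = 2"
    using a real_zeta_2_less continuous_on_subset[OF continuous_on_real_zeta[OF a(1)], of "{a..2}"]
    by (intro IVT2') auto
  then obtain s where s: "1 < s" "real_zeta s = 2" using a by (meson less_le_trans)
  have "rho = s"
    unfolding rho_def
  proof (rule the_equality)
    show "t = s" if "1 < t \<and> real_zeta t = 2" for t
      using real_zeta_strict_antimono[of s t] real_zeta_strict_antimono[of t s] that s
      by (cases s t rule: linorder_cases) auto
  qed (use s in auto)
  thus "1 < rho" "real_zeta rho = 2" using s by auto
  show "rho < 2"
  proof (rule ccontr)
    assume "\<not> rho < 2"
    hence "real_zeta rho \<le> real_zeta 2"
      using real_zeta_strict_antimono[of 2 rho] by (cases "rho = 2") auto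
    thus False using real_zeta_2_less \<open>real_zeta rho = 2\<close> by simp
  qed
qed

lemma sum_powr_le_zeta:
  assumes "s > 1" "finite A" "0 \<notin> A"
  shows "(\<Sum>n\<in>A. real n powr -s) \<le> real_zeta s"
proof -
  have "(\<Sum>n\<in>A. real n powr -s) = (\<Sum>n\<in>(\<lambda>n. n - 1) ` A. real (Suc n) powr -s)"
  proof (rule sum.reindex_bij_witness[of _ Suc "\<lambda>n. n - 1"])
    fix n assume "n \<in> A"
    hence "n > 0" using assms(3) by (cases n) auto
    thus "Suc (n - 1) = n" "real (Suc (n - 1)) powr -s = real n powr -s" by simp_all
  next
    fix n assume "n \<in> (\<lambda>n. n - 1) ` A"
    then obtain k where "k \<in> A" "n = k - 1" by auto
    thus "Suc n \<in> A" using assms(3) by (cases k) auto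
  qed auto
  also have "\<dots> \<le> real_zeta s"
    unfolding real_zeta_alt using assms by (intro sum_le_suminf real_zeta_summable) auto
  finally show ?thesis .
qed

text \<open>
  The form in which \<open>\<zeta>(\<rho>) = 2\<close> enters every upper bound: the weights \<open>n\<^sup>-\<^sup>\<rho>\<close>, \<open>n \<ge> 2\<close>, are
  probabilities.
\<close>
lemma sum_powr_rho_le_1:
  assumes "finite A" "\<And>n. n \<in> A \<Longrightarrow> n \<ge> 2"
  shows "(\<Sum>n\<in>A. real n powr -rho) \<le> 1"
proof -
  have "1 \<notin> A" using assms(2)[of 1] by auto
  have "(\<Sum>n\<in>insert 1 A. real n powr -rho) \<le> real_zeta rho"
    using assms rho_props by (intro sum_powr_le_zeta) force+
  thus ?thesis using \<open>1 \<notin> A\<close> assms rho_props by simp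
qed

lemma sum_powr_rho_ge:
  assumes "X \<ge> 1"
  shows "(\<Sum>n\<in>{2..X}. real n powr -rho) \<ge> 1 - real X powr (1-rho) / (rho-1)"
proof -
  have "(\<Sum>i<N. real (Suc i) powr -rho) \<le>
     1 + (\<Sum>n\<in>{2..X}. real n powr -rho) + real X powr (1-rho) / (rho-1)" for N
  proof -
    have "(\<Sum>i<N. real (Suc i) powr -rho) = (\<Sum>n\<in>{0<..N}. real n powr -rho)"
      by (rule sum.reindex_bij_witness[of _ "\<lambda>n. n - 1" Suc]) auto
    also have "\<dots> \<le> (\<Sum>n\<in>insert 1 ({2..X} \<union> {X<..N}). real n powr -rho)"
      by (intro sum_mono2) auto
    also have "\<dots> = 1 + (\<Sum>n\<in>{2..X}. real n powr -rho) + (\<Sum>n\<in>{X<..N}. real n powr -rho)"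
      using assms by (simp, subst sum.union_disjoint) auto
    also have "(\<Sum>n\<in>{X<..N}. real n powr -rho) \<le> real X powr (1-rho) / (rho-1)"
      using powr_tail[of rho X N] rho_props assms by auto
    finally show ?thesis by simp
  qed
  hence "real_zeta rho \<le> 1 + (\<Sum>n\<in>{2..X}. real n powr -rho) + real X powr (1-rho) / (rho-1)"
    unfolding real_zeta_alt using rho_props by (intro suminf_le_const real_zeta_summable) auto
  thus ?thesis using rho_props by simp
qed

section \<open>Chebyshev's bounds for primes\<close>

lemma prod_distinct_primes_dvd:
  fixes m :: nat
  assumes "finite A" "\<And>p. p \<in> A \<Longrightarrow> prime p" "\<And>p. p \<in> A \<Longrightarrow> p dvd m"
  shows "\<Prod>A dvd m"
  using assms
proof (induction A)
  case (insert p A)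
  have "coprime p (\<Prod>A)"
    using insert by (intro prod_coprime_right) (metis insertCI primes_coprime)
  thus ?case using insert by (simp add: divides_mult)
qed auto

lemma middle_binomial_odd_le: "(2*m+1) choose m \<le> 4^m"
proof -
  have "2 * ((2*m+1) choose m) = (\<Sum>k\<in>{m,m+1}. (2*m+1) choose k)"
    using binomial_symmetric[of m "2*m+1"] by simp
  also have "\<dots> \<le> (\<Sum>k\<le>2*m+1. (2*m+1) choose k)"
    by (intro sum_mono2) auto
  also have "\<dots> = 2 * 4^m"
    using choose_row_sum[of "2*m+1"] by (simp add: power_mult)
  finally show ?thesis by simp
qed

text \<open>
  Erdos's argument: the primes in \<open>(m+1, 2m+1]\<close> all divide the middle binomial coefficient, which is at
  most \<open>4\<^sup>m\<close>.
\<close>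
lemma prod_primes_le: "\<Prod>{p. prime p \<and> p \<le> n} \<le> (4::nat)^n"
proof (induction n rule: less_induct)
  case (less n)
  consider "n \<le> 1" | "n = 2" | "n > 2" "even n" | "n > 2" "odd n" by linarith
  thus ?case
  proof cases
    case 1
    hence *: "{p. prime p \<and> p \<le> n} = {}" by (auto dest: prime_ge_2_nat)
    show ?thesis unfolding * by simp
  next
    case 2
    hence *: "{p. prime p \<and> p \<le> n} = {2}" by (auto dest: prime_ge_2_nat)
    show ?thesis unfolding * by (simp add: 2)
  next
    case 3
    hence "\<not> prime n" using prime_odd_nat by blast
    have *: "{p. prime p \<and> p \<le> n} = {p. prime p \<and> p \<le> n-1}"
    proof (rule Collect_cong)
      fix p show "(prime p \<and> p \<le> n) = (prime p \<and> p \<le> n - 1)"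
        using \<open>\<not> prime n\<close> by (cases "p = n") auto
    qed
    have "\<Prod>{p. prime p \<and> p \<le> n-1} \<le> (4::nat)^(n-1)" using 3 by (intro less) auto
    also have "(4::nat)^(n-1) \<le> 4^n" by (intro power_increasing) auto
    finally show ?thesis unfolding * .
  next
    case 4
    then obtain m where m: "n = 2*m+1" "m \<ge> 1" by (auto elim!: oddE)
    let ?B = "{p. prime p \<and> m+1 < p \<and> p \<le> n}"
    have fin: "finite ?B" "finite {p. prime p \<and> p \<le> m+1}" by auto
    have *: "{p. prime p \<and> p \<le> n} = {p. prime p \<and> p \<le> m+1} \<union> ?B" using m(1) by auto
    have "\<Prod>{p. prime p \<and> p \<le> n} = \<Prod>{p. prime p \<and> p \<le> m+1} * \<Prod>?B"
      unfolding * by (rule prod.union_disjoint) (use fin in auto)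
    also have "\<dots> \<le> 4^(m+1) * 4^m"
    proof (rule mult_mono)
      show "\<Prod>{p. prime p \<and> p \<le> m+1} \<le> 4^(m+1)" using m by (intro less) auto
      have "\<Prod>?B \<le> n choose m"
      proof (rule dvd_imp_le)
        show "\<Prod>?B dvd n choose m"
        proof (rule prod_distinct_primes_dvd[OF fin(1)])
          fix p assume p: "p \<in> ?B"
          have "fact m * fact (n - m) * (n choose m) = (fact n :: nat)"
            using m by (intro binomial_fact_lemma) auto
          moreover have "p dvd fact n" using p by (auto simp: prime_dvd_fact_iff)
          moreover have "\<not> p dvd fact m" "\<not> p dvd fact (n - m)"
            using p m by (auto simp: prime_dvd_fact_iff simp del: fact_Suc)
          ultimately show "p dvd n choose m" using p by (metis (mono_tags) mem_Collect_eq prime_dvd_mult_iff)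
        qed auto
        show "0 < n choose m" using m by simp
      qed
      also have "n choose m \<le> 4^m" using middle_binomial_odd_le m by simp
      finally show "\<Prod>?B \<le> 4^m" .
    qed auto
    also have "4^(m+1) * 4^m = (4::nat)^n" unfolding m(1) by (simp add: mult_2 power_add)
    finally show ?thesis by simp
  qed
qed

definition prime_ln :: "nat \<Rightarrow> real" where
  "prime_ln n = (if prime n then ln (real n) else 0)"

lemma prime_ln_nonneg: "prime_ln n \<ge> 0"
  by (auto simp: prime_ln_def dest: prime_ge_1_nat)

lemma theta_le: "(\<Sum>k\<in>{0<..n}. prime_ln k) \<le> ln 4 * real n"
proof -
  have "(\<Sum>k\<in>{0<..n}. prime_ln k) = (\<Sum>p | prime p \<and> p \<le> n. ln (real p))"
    by (intro sum.mono_neutral_cong_right) (auto simp: prime_ln_def dest: prime_gt_0_nat)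
  also have "\<dots> = ln (\<Prod>p | prime p \<and> p \<le> n. real p)"
    by (subst ln_prod) (auto dest: prime_gt_0_nat)
  also have "\<dots> = ln (real (\<Prod>{p. prime p \<and> p \<le> n}))"
    by (simp add: of_nat_prod)
  also have "\<dots> \<le> ln (real (4^n))"
    by (subst ln_le_cancel_iff)
       (auto simp del: of_nat_power of_nat_prod simp: prod_primes_le intro!: prod_pos dest: prime_gt_0_nat)
  also have "\<dots> = ln 4 * real n" by (simp add: ln_realpow)
  finally show ?thesis .
qed

text \<open>
  Induction on \<open>k\<close> in Leibniz's harmonic triangle. With \<open>D\<close> the least common multiple, its rule
  \<open>1/((k+1) C(n,k+1)) = 1/(k C(n-1,k)) - 1/(k C(n,k))\<close> writes the quotient of \<open>D\<close> by \<open>(k+1) C(n,k+1)\<close> as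
  a difference of two integers. The point is that prime powers dividing a binomial coefficient are
  then at most \<open>n\<close>, which replaces Legendre's formula for factorials.
\<close>
lemma mult_binomial_dvd_Lcm:
  assumes "1 \<le> k" "k \<le> n"
  shows "k * (n choose k) dvd (Lcm {1..n} :: nat)"
  using assms
proof (induction k arbitrary: n rule: dec_induct)
  case base
  thus ?case by (auto intro: dvd_Lcm)
next
  case (step k)
  have "1 \<le> k" "Suc k \<le> n" using step by auto
  obtain l where n: "n = Suc l" using \<open>Suc k \<le> n\<close> by (cases n) auto
  obtain j where k: "k = Suc j" using \<open>1 \<le> k\<close> by (cases k) auto
  define D where "D = (Lcm {1..n} :: nat)"
  have "Lcm {1..l} dvd D" unfolding D_def n by (intro Lcm_subset) auto
  moreover have "k * (l choose k) dvd Lcm {1..l}" using step n by auto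
  ultimately have "k * (l choose k) dvd D" by (rule dvd_trans[rotated])
  then obtain u where u: "D = k * (l choose k) * u" by (auto elim: dvdE)
  have "k * (n choose k) dvd D" using step n unfolding D_def by auto
  then obtain v where v: "D = k * (n choose k) * v" by (auto elim: dvdE)
  have 1: "k * (n choose k) = n * (l choose j)"
    using Suc_times_binomial_eq[of l j] unfolding n k by (simp only: mult.commute)
  have 2: "Suc k * (n choose Suc k) = n * (l choose k)"
    using Suc_times_binomial_eq[of l k] unfolding n by (simp only: mult.commute)
  have 3: "int k * int (l choose k) = (int n - int k) * int (l choose j)"
  proof -
    have "k * (l choose k) = (l - j) * (l choose j)"
      unfolding k by (simp only: binomial_absorption binomial_absorb_comp)
    hence "int (k * (l choose k)) = int ((l - j) * (l choose j))" by (simp only:)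
    moreover have "int (l - j) = int n - int k" using n k step by simp
    ultimately show ?thesis by simp
  qed
  have "int k * int D = int k * (int (n * (l choose k)) * (int u - int v))"
  proof -
    have a: "int D = int k * int (l choose k) * int u" using u by (metis of_nat_mult)
    have b: "int D = int n * int (l choose j) * int v" using v 1 by (metis of_nat_mult)
    have "int k * (int n * int (l choose k) * (int u - int v))
        = int n * (int k * int (l choose k) * int u) - int n * (int k * int (l choose k)) * int v"
      by (simp add: algebra_simps)
    also have "\<dots> = int n * int D - (int n - int k) * (int n * int (l choose j) * int v)"
      unfolding a[symmetric] unfolding 3 by (simp add: algebra_simps)
    also have "\<dots> = int k * int D" unfolding b[symmetric] by (simp add: algebra_simps)
    finally show ?thesis by (simp only: of_nat_mult)
  qed
  hence "int D = int (n * (l choose k)) * (int u - int v)" using step by simp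
  hence "int (n * (l choose k)) dvd int D" by (metis dvd_triv_left)
  thus ?case using 2 by (simp add: D_def del: of_nat_mult binomial_Suc_Suc)
qed

lemma prime_power_dvd_Lcm_le:
  assumes "prime p" "p ^ j dvd (Lcm {1..n} :: nat)" "n \<ge> 1"
  shows "p ^ j \<le> n"
  using assms(2,3)
proof (induction n)
  case (Suc n)
  have eq: "Lcm {1..Suc n} = lcm (Suc n) (Lcm {1..n} :: nat)"
    by (simp add: atLeastAtMostSuc_conv)
  have "p ^ j dvd Suc n \<or> p ^ j dvd Lcm {1..n}"
  proof -
    have nz: "Suc n \<noteq> 0" "(Lcm {1..n} :: nat) \<noteq> 0" by auto
    have "j \<le> multiplicity p (lcm (Suc n) (Lcm {1..n}))"
      using Suc.prems(1) assms(1) nz unfolding eq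
      by (subst (asm) power_dvd_iff_le_multiplicity) (auto simp: lcm_eq_0_iff)
    also have "\<dots> = max (multiplicity p (Suc n)) (multiplicity p (Lcm {1..n}))"
      using nz assms(1) by (intro multiplicity_lcm) auto
    finally show ?thesis using multiplicity_dvd' by (metis le_max_iff_disj)
  qed
  thus ?case
  proof
    assume "p ^ j dvd Suc n"
    thus ?thesis by (intro dvd_imp_le) auto
  next
    assume *: "p ^ j dvd Lcm {1..n}"
    show ?thesis
    proof (cases "n = 0")
      case True
      thus ?thesis using * by (auto simp: power_eq_if)
    next
      case False
      thus ?thesis using Suc.IH * by auto
    qed
  qed
qed auto

definition prime_count :: "nat \<Rightarrow> nat" where
  "prime_count n = card {p. prime p \<and> p \<le> n}"

lemma prime_count_mono: "m \<le> n \<Longrightarrow> prime_count m \<le> prime_count n"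
  unfolding prime_count_def by (intro card_mono) auto

lemma binomial_le_power_prime_count:
  assumes "n \<ge> 1" "1 \<le> k" "k \<le> n"
  shows "n choose k \<le> n ^ prime_count n"
proof -
  define m where "m = n choose k"
  have m0: "m > 0" using assms by (simp add: m_def)
  have pw: "p ^ multiplicity p m \<le> n" if "prime p" for p
  proof (rule prime_power_dvd_Lcm_le[OF that])
    have "p ^ multiplicity p m dvd k * m" by (simp add: multiplicity_dvd)
    also have "\<dots> dvd Lcm {1..n}" unfolding m_def by (rule mult_binomial_dvd_Lcm[OF assms(2,3)])
    finally show "p ^ multiplicity p m dvd Lcm {1..n}" .
  qed fact
  have sub: "prime_factors m \<subseteq> {p. prime p \<and> p \<le> n}"
  proof safe
    fix p assume p: "p \<in> prime_factors m"
    thus "prime p" by auto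
    have "p \<le> p ^ multiplicity p m"
      using p by (intro self_le_power) (auto simp: prime_factors_multiplicity dest: prime_ge_1_nat)
    also have "\<dots> \<le> n" using pw p by auto
    finally show "p \<le> n" .
  qed
  have "m = (\<Prod>p\<in>prime_factors m. p ^ multiplicity p m)"
    using m0 by (metis gr_implies_not_zero prime_factorization_nat)
  also have "\<dots> \<le> (\<Prod>p\<in>prime_factors m. n)"
    using pw by (intro prod_mono) auto
  also have "\<dots> = n ^ card (prime_factors m)" by simp
  also have "\<dots> \<le> n ^ prime_count n"
    unfolding prime_count_def using assms sub by (intro power_increasing card_mono) auto
  finally show ?thesis by (simp add: m_def)
qed

lemma prime_count_lower:
  assumes "T \<ge> 2"
  shows "real (prime_count T) \<ge> ln 2 / 3 * (real T / ln (real T))"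
proof -
  define n where "n = T div 2"
  have n: "n \<ge> 1" "2*n \<le> T" "T \<le> 3*n" using assms by (auto simp: n_def)
  have "2^n \<le> (2*n) choose n"
  proof -
    have "2 * real n \<le> 2^n"
    proof -
      have "2*n \<le> 2^n" using n(1)
      proof (induction n rule: dec_induct)
        case (step k)
        have "(2::nat) \<le> 2^k" using step by (simp add: self_le_power)
        thus ?case using step by simp
      qed auto
      hence "real (2*n) \<le> real (2^n)" by (simp only: of_nat_le_iff)
      thus ?thesis by simp
    qed
    hence "(2::real)^n \<le> 4^n / (2 * real n)"
    proof -
      assume "2 * real n \<le> 2^n"
      hence "2^n * (2 * real n) \<le> 2^n * (2::real)^n" by (intro mult_left_mono) auto
      also have "\<dots> = 4^n" by (simp flip: power_mult_distrib)
      finally show ?thesis using n by (simp add: le_divide_eq)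
    qed
    also have "\<dots> \<le> real ((2*n) choose n)" using central_binomial_lower_bound[of n] n by simp
    finally have "real (2^n) \<le> real ((2*n) choose n)" by simp
    thus ?thesis by (simp only: of_nat_le_iff)
  qed
  also have "\<dots> \<le> (2*n) ^ prime_count (2*n)" using n by (intro binomial_le_power_prime_count) auto
  also have "\<dots> \<le> T ^ prime_count (2*n)" using n by (intro power_mono) auto
  also have "\<dots> \<le> T ^ prime_count T"
    using n assms prime_count_mono[of "2*n" T] by (intro power_increasing) auto
  finally have "real (2^n) \<le> real (T ^ prime_count T)" by (simp only: of_nat_le_iff)
  hence "ln (real (2^n)) \<le> ln (real (T ^ prime_count T))"
    using assms by (subst ln_le_cancel_iff) auto
  hence "real n * ln 2 \<le> real (prime_count T) * ln (real T)"
    using assms by (simp add: ln_realpow)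
  moreover have "real T / 3 * ln 2 \<le> real n * ln 2"
    using n by (intro mult_right_mono) auto
  ultimately have "real T * ln 2 / 3 \<le> real (prime_count T) * ln (real T)" by (smt (verit) times_divide_eq_left)
  thus ?thesis using assms by (simp add: field_simps)
qed

section \<open>Sums over primes\<close>

text \<open>
  Abel summation in the form of a comparison: if the averages of \<open>a\<close> are at most \<open>c\<close>, then against decreasing
  weights it sums to no more than the constant \<open>c\<close> would. The boundary term accounts for what \<open>a\<close> may
  have saved up below \<open>y\<close>. The induction works because it keeps the unused allowance
  \<open>(c m - S m) b\<^sub>m\<close> on the left-hand side.
\<close>
lemma partial_summation_bound:
  fixes a b :: "nat \<Rightarrow> real"
  assumes a: "\<And>n. a n \<ge> 0"
    and A: "\<And>n. (\<Sum>k\<in>{0<..n}. a k) \<le> c * real n"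
    and b: "\<And>n. y \<le> n \<Longrightarrow> n < M \<Longrightarrow> b (Suc n) \<le> b n"
    and b0: "\<And>n. y \<le> n \<Longrightarrow> n \<le> M \<Longrightarrow> b n \<ge> 0"
    and "y \<le> M"
  shows "(\<Sum>n\<in>{y<..M}. a n * b n) \<le> c * (real y * b y + (\<Sum>n\<in>{y<..M}. b n))"
proof -
  define S where "S = (\<lambda>n. \<Sum>k\<in>{0<..n}. a k)"
  have "(\<Sum>n\<in>{y<..m}. a n * b n) + (c * real m - S m) * b m
      \<le> c * (real y * b y + (\<Sum>n\<in>{y<..m}. b n))" if "y \<le> m" "m \<le> M" for m
    using that
  proof (induction m rule: dec_induct)
    case base
    have "S y * b y \<ge> 0" unfolding S_def using b0 assms(5) a
      by (intro mult_nonneg_nonneg sum_nonneg) auto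
    thus ?case by (simp add: algebra_simps)
  next
    case (step m)
    have ins: "{y<..Suc m} = insert (Suc m) {y<..m}" "{0<..Suc m} = insert (Suc m) {0<..m}"
      using step by auto
    have SS: "S (Suc m) = S m + a (Suc m)" unfolding S_def ins by simp
    have "(c * real m - S m) * b (Suc m) \<le> (c * real m - S m) * b m"
      using A[of m] b[of m] step by (intro mult_left_mono) (auto simp: S_def)
    moreover have "(\<Sum>n\<in>{y<..m}. a n * b n) + (c * real m - S m) * b m
      \<le> c * (real y * b y + (\<Sum>n\<in>{y<..m}. b n))" using step by auto
    ultimately show ?case unfolding ins SS by (simp add: algebra_simps)
  qed
  from this[of M] have "(\<Sum>n\<in>{y<..M}. a n * b n) + (c * real M - S M) * b M
      \<le> c * (real y * b y + (\<Sum>n\<in>{y<..M}. b n))" using assms by auto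
  moreover have "(c * real M - S M) * b M \<ge> 0"
    using A[of M] b0[of M] assms(5) by (intro mult_nonneg_nonneg) (auto simp: S_def)
  ultimately show ?thesis by linarith
qed

text \<open>
  Since \<open>ln p \<ge> ln y\<close>, it suffices to bound \<open>\<Sum> ln p p\<^sup>-\<^sup>s\<close>, where \<open>ln p\<close> may be replaced by a constant on
  average.
\<close>
lemma prime_powr_tail:
  assumes "s > 1"
  shows "\<exists>C>0. \<forall>y\<ge>2. \<forall>P. finite P \<longrightarrow> (\<forall>p\<in>P. prime p \<and> y < p) \<longrightarrow>
           (\<Sum>p\<in>P. real p powr -s) \<le> C * (real y powr (1-s) / ln (real y))"
proof (intro exI[of _ "ln 4 * (1 + 1/(s-1))"] conjI allI impI)
  show "ln 4 * (1 + 1/(s-1)) > 0" using assms by (intro mult_pos_pos add_pos_pos) auto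
  fix y :: nat and P :: "nat set"
  assume y: "y \<ge> 2" and P: "finite P" "\<forall>p\<in>P. prime p \<and> y < p"
  define M where "M = Max (insert y P)"
  have M: "y \<le> M" "\<And>p. p \<in> P \<Longrightarrow> p \<le> M" using P by (auto simp: M_def)
  have lny: "ln (real y) > 0" using y by simp
  have "ln (real y) * (\<Sum>p\<in>P. real p powr -s) = (\<Sum>p\<in>P. ln (real y) * real p powr -s)"
    by (simp add: sum_distrib_left)
  also have "\<dots> \<le> (\<Sum>p\<in>P. prime_ln p * real p powr -s)"
    using P y by (intro sum_mono mult_right_mono) (auto simp: prime_ln_def)
  also have "\<dots> \<le> (\<Sum>p\<in>{y<..M}. prime_ln p * real p powr -s)"
    using P M by (intro sum_mono2) (auto intro!: mult_nonneg_nonneg prime_ln_nonneg)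
  also have "\<dots> \<le> ln 4 * (real y * real y powr -s + (\<Sum>n\<in>{y<..M}. real n powr -s))"
    using M assms y
    by (intro partial_summation_bound prime_ln_nonneg theta_le powr_mono2') auto
  also have "real y * real y powr -s = real y powr (1-s)"
    using y by (simp add: powr_diff powr_minus divide_inverse)
  also have "ln 4 * (real y powr (1-s) + (\<Sum>n\<in>{y<..M}. real n powr -s))
      \<le> ln 4 * (real y powr (1-s) + real y powr (1-s) / (s-1))"
    using powr_tail[of s y M] assms y by (intro mult_left_mono add_left_mono) auto
  finally show "(\<Sum>p\<in>P. real p powr -s) \<le> ln 4 * (1 + 1/(s-1)) * (real y powr (1-s) / ln (real y))"
    using lny by (simp add: field_simps)
qed

text \<open>
  Exponentiated, this says that the single term \<open>Y\<^sup>m / m!\<close> of the exponential series is at most \<open>exp Y\<close>.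
\<close>
lemma sum_ln_quotient_le:
  assumes "Y > 0"
  shows "(\<Sum>n\<in>{0<..m}. ln (Y / real n)) \<le> Y"
proof -
  have "Y ^ m / fact m \<le> exp Y"
  proof -
    have "(\<Sum>n\<in>{m}. Y ^ n /\<^sub>R fact n) \<le> (\<Sum>n. Y ^ n /\<^sub>R fact n)"
      using assms summable_exp_generic[of Y] by (intro sum_le_suminf) auto
    thus ?thesis by (simp add: exp_def field_simps)
  qed
  have "(\<Sum>n\<in>{0<..m}. ln (Y / real n)) = ln (\<Prod>n\<in>{0<..m}. Y / real n)"
    using assms by (subst ln_prod) auto
  also have "(\<Prod>n\<in>{0<..m}. Y / real n) = Y ^ m / fact m"
    by (simp add: prod_dividef fact_prod of_nat_prod) (metis atLeastSucAtMost_greaterThanAtMost One_nat_def)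
  also have "ln \<dots> \<le> ln (exp Y)"
    using assms \<open>Y ^ m / fact m \<le> exp Y\<close> by (subst ln_le_cancel_iff) auto
  finally show ?thesis by simp
qed

text \<open>
  This sum measures the logarithm of the number of typical products. Primes up to \<open>\<surd>Y\<close> contribute
  \<open>O(\<surd>Y ln Y)\<close>; for the others \<open>1 \<le> 2 ln p / ln Y\<close>, and \<open>ln p\<close> is constant on average.
\<close>
lemma prime_ln_quotient_sum:
  "\<exists>C>0. \<forall>Y\<ge>2. (\<Sum>p | prime p \<and> p \<le> nat \<lfloor>Y\<rfloor>. 1 + ln (Y / real p)) \<le> C * (Y / ln Y)"
proof (intro exI[of _ "20 + 4 * ln 4"] conjI allI impI)
  show "20 + 4 * ln 4 > (0::real)" by (intro add_pos_pos) auto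
  fix Y :: real assume Y: "Y \<ge> 2"
  define y where "y = nat \<lfloor>Y\<rfloor>"
  have y: "y \<ge> 2" "real y \<le> Y" using Y by (auto simp: y_def le_nat_iff le_floor_iff)
  have lnY: "ln Y > 0" using Y by simp
  define w where "w = (\<lambda>n. 1 + ln (Y / real n))"
  have w_ge: "w n \<ge> 1" if "0 < n" "n \<le> y" for n
    using that y by (auto simp: w_def)
  have w_le: "w n \<le> 1 + ln Y" if "0 < n" "n \<le> y" for n
    using that Y by (auto simp: w_def ln_div)
  have le: "w p \<le> (if real p \<le> sqrt Y then 1 + ln Y else 0) + 2 / ln Y * (prime_ln p * w p)"
    if p: "prime p" "p \<le> y" for p
  proof -
    have p0: "p > 0" using p(1) prime_gt_0_nat by blast
    have nn: "2 / ln Y * (prime_ln p * w p) \<ge> 0"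
      using lnY w_ge[OF p0 p(2)] prime_ln_nonneg[of p] by (intro mult_nonneg_nonneg divide_nonneg_nonneg) auto
    show ?thesis
    proof (cases "real p \<le> sqrt Y")
      case True
      thus ?thesis using nn w_le[OF p0 p(2)] by simp
    next
      case False
      hence "ln (sqrt Y) \<le> ln (real p)" using Y p0 by (subst ln_le_cancel_iff) auto
      hence "ln Y / 2 \<le> ln (real p)" using Y by (simp add: ln_sqrt)
      hence "1 \<le> 2 / ln Y * prime_ln p" using lnY p by (simp add: prime_ln_def field_simps)
      hence "1 * w p \<le> (2 / ln Y * prime_ln p) * w p"
        using w_ge[OF p0 p(2)] by (intro mult_right_mono) auto
      thus ?thesis using False by (simp add: mult.assoc)
    qed
  qed
  have "(\<Sum>p | prime p \<and> p \<le> y. w p) \<le>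
      (\<Sum>p | prime p \<and> p \<le> y. (if real p \<le> sqrt Y then 1 + ln Y else 0) + 2 / ln Y * (prime_ln p * w p))"
    using le by (intro sum_mono) auto
  also have "\<dots> \<le> (\<Sum>p\<in>{1<..y}. (if real p \<le> sqrt Y then 1 + ln Y else 0) + 2 / ln Y * (prime_ln p * w p))"
  proof (intro sum_mono2)
    show "{p. prime p \<and> p \<le> y} \<subseteq> {1<..y}" using prime_gt_1_nat by auto
    fix n assume "n \<in> {1<..y} - {p. prime p \<and> p \<le> y}"
    thus "0 \<le> (if real n \<le> sqrt Y then 1 + ln Y else 0) + 2 / ln Y * (prime_ln n * w n)"
      using lnY w_ge[of n] by (auto simp: prime_ln_def)
  qed auto
  also have "\<dots> = (\<Sum>p\<in>{1<..y}. if real p \<le> sqrt Y then 1 + ln Y else 0)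
       + 2 / ln Y * (\<Sum>p\<in>{1<..y}. prime_ln p * w p)"
    by (simp add: sum.distrib sum_distrib_left)
  also have "(\<Sum>p\<in>{1<..y}. if real p \<le> sqrt Y then 1 + ln Y else 0) \<le> sqrt Y * (1 + ln Y)"
  proof -
    have "(\<Sum>p\<in>{1<..y}. if real p \<le> sqrt Y then 1 + ln Y else 0)
        = (\<Sum>p\<in>{p\<in>{1<..y}. real p \<le> sqrt Y}. 1 + ln Y)"
      by (intro sum.mono_neutral_cong_right) auto
    also have "\<dots> = real (card {p\<in>{1<..y}. real p \<le> sqrt Y}) * (1 + ln Y)" by simp
    also have "card {p\<in>{1<..y}. real p \<le> sqrt Y} \<le> card {0<..nat \<lfloor>sqrt Y\<rfloor>}"
      using Y by (intro card_mono) (auto simp: le_nat_iff le_floor_iff)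
    also have "card {0<..nat \<lfloor>sqrt Y\<rfloor>} = nat \<lfloor>sqrt Y\<rfloor>" by simp
    also have "real (nat \<lfloor>sqrt Y\<rfloor>) * (1 + ln Y) \<le> sqrt Y * (1 + ln Y)"
      using Y lnY by (intro mult_right_mono) auto
    finally show ?thesis using lnY by (simp add: mult_right_mono)
  qed
  also have "(\<Sum>p\<in>{1<..y}. prime_ln p * w p) \<le> ln 4 * (real 1 * w 1 + (\<Sum>n\<in>{1<..y}. w n))"
  proof (intro partial_summation_bound prime_ln_nonneg theta_le)
    show "w (Suc n) \<le> w n" if "1 \<le> n" "n < y" for n
      using that Y unfolding w_def by (intro add_left_mono, subst ln_le_cancel_iff) (auto intro!: divide_left_mono)
    show "w n \<ge> 0" if "1 \<le> n" "n \<le> y" for n using w_ge[of n] that by auto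
  qed (use y in auto)
  also have "real 1 * w 1 + (\<Sum>n\<in>{1<..y}. w n) = (\<Sum>n\<in>{0<..y}. w n)"
  proof -
    have "{0<..y} = insert 1 {1<..y}" using y by auto
    thus ?thesis by simp
  qed
  also have "\<dots> \<le> 2 * Y"
    using sum_ln_quotient_le[of Y y] y Y by (simp add: w_def sum.distrib)
  finally have "(\<Sum>p | prime p \<and> p \<le> y. w p) \<le> sqrt Y * (1 + ln Y) + 2 / ln Y * (ln 4 * (2 * Y))"
    using lnY by (simp add: divide_right_mono mult_left_mono)
  also have "sqrt Y * (1 + ln Y) \<le> 20 * (Y / ln Y)"
  proof -
    have q: "ln Y \<le> Y powr (1/4) / (1/4)" using Y by (intro ln_powr_bound) auto
    have "1 \<le> Y powr (1/4)" using Y by (intro ge_one_powr_ge_zero) auto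
    hence "(1 + ln Y) * ln Y \<le> (5 * Y powr (1/4)) * (4 * Y powr (1/4))"
      using q lnY by (intro mult_mono) auto
    also have "\<dots> = 20 * sqrt Y" using Y by (simp add: powr_half_sqrt flip: powr_add)
    finally have "sqrt Y * ((1 + ln Y) * ln Y) \<le> sqrt Y * (20 * sqrt Y)"
      using Y by (intro mult_left_mono) auto
    also have "\<dots> = 20 * Y" using Y by simp
    finally show ?thesis using lnY by (simp add: field_simps)
  qed
  finally show "(\<Sum>p | prime p \<and> p \<le> nat \<lfloor>Y\<rfloor>. 1 + ln (Y / real p)) \<le> (20 + 4 * ln 4) * (Y / ln Y)"
    unfolding y_def[symmetric] w_def by (simp add: algebra_simps)
qed

section \<open>The recursion behind the upper bounds for K\<close>

lemma prod_list_ge_power2: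
  assumes "\<forall>x\<in>set xs. (2::nat) \<le> x"
  shows "2 ^ length xs \<le> prod_list xs"
  using assms by (induction xs) (auto intro: mult_mono)

lemma finite_ordered_factorizations: "finite (ordered_factorizations n)"
proof (cases "n = 0")
  case True
  have *: "prod_list xs \<noteq> 0" if "\<forall>x\<in>set xs. (2::nat) \<le> x" for xs
    using that by (auto simp: prod_list_zero_iff)
  hence "ordered_factorizations n = {}"
    using True * unfolding ordered_factorizations_def by blast
  thus ?thesis by simp
next
  case False
  have "ordered_factorizations n \<subseteq> {xs. set xs \<subseteq> {..n} \<and> length xs \<le> n}"
  proof safe
    fix xs assume xs: "xs \<in> ordered_factorizations n"
    show "x \<le> n" if "x \<in> set xs" for x
      using xs that False by (auto simp: ordered_factorizations_def intro!: dvd_imp_le prod_list_dvd)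
    have "length xs < 2 ^ length xs" by simp
    also have "\<dots> \<le> n" using xs prod_list_ge_power2[of xs] by (auto simp: ordered_factorizations_def)
    finally show "length xs \<le> n" by simp
  qed
  thus ?thesis using finite_lists_length_le[of "{..n}" n] finite_subset by blast
qed

lemma kalmar_K_pos:
  assumes "n > 0"
  shows "kalmar_K n > 0"
proof (cases "n = 1")
  case False
  hence "[n] \<in> ordered_factorizations n" using assms by (auto simp: ordered_factorizations_def)
  thus ?thesis using False finite_ordered_factorizations[of n]
    by (auto simp: kalmar_K_def card_gt_0_iff)
qed (auto simp: kalmar_K_def)

text \<open>
  Split off the first factor \<open>d\<close>. The remaining list may be empty, when \<open>d = n\<close>; the convention
  \<open>K(1) = 1\<close> counts exactly that case.
\<close>
lemma kalmar_K_le_sum: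
  assumes "n \<ge> 2"
  shows "kalmar_K n \<le> (\<Sum>d | d dvd n \<and> d \<ge> 2. kalmar_K (n div d))"
proof -
  \<comment> \<open>factorizations that may have no factor at all: \<open>card (G m) = K(m)\<close> also for \<open>m = 1\<close>\<close>
  define G where "G = (\<lambda>m. ordered_factorizations m \<union> (if m = 1 then {[]} else {}))"
  have K: "card (G m) = kalmar_K m" if "m > 0" for m
  proof (cases "m = 1")
    case True
    have "ordered_factorizations 1 = {}"
    proof (safe, goal_cases)
      case (1 xs)
      hence "xs \<noteq> []" "2 ^ length xs \<le> (1::nat)"
        using prod_list_ge_power2[of xs] by (auto simp: ordered_factorizations_def)
      moreover have "length xs < 2 ^ length xs" by simp
      ultimately have "length xs < 1" by linarith
      thus ?case using \<open>xs \<noteq> []\<close> by simp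
    qed
    thus ?thesis using True by (simp add: G_def kalmar_K_def)
  qed (simp add: G_def kalmar_K_def)
  have finG: "finite (G m)" for m using finite_ordered_factorizations by (simp add: G_def)
  have fin: "finite {d. d dvd n \<and> d \<ge> 2}"
    using assms by (intro finite_subset[OF _ finite_divisors_nat[of n]]) auto
  have "ordered_factorizations n \<subseteq> (\<Union>d\<in>{d. d dvd n \<and> d \<ge> 2}. (#) d ` G (n div d))"
  proof
    fix xs assume xs: "xs \<in> ordered_factorizations n"
    then obtain d ys where d: "xs = d # ys" "d \<ge> 2" "d * prod_list ys = n" "\<forall>x\<in>set ys. x \<ge> 2"
      by (cases xs) (auto simp: ordered_factorizations_def)
    have "n div d = prod_list ys" using d(2,3) by auto
    hence "ys \<in> G (n div d)" using d by (cases "ys = []") (auto simp: G_def ordered_factorizations_def)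
    moreover have "d \<in> {d. d dvd n \<and> d \<ge> 2}" using d by auto
    ultimately show "xs \<in> (\<Union>d\<in>{d. d dvd n \<and> d \<ge> 2}. (#) d ` G (n div d))"
      unfolding d(1) by blast
  qed
  hence "kalmar_K n \<le> card (\<Union>d\<in>{d. d dvd n \<and> d \<ge> 2}. (#) d ` G (n div d))"
    using assms fin finG by (auto simp: kalmar_K_def intro!: card_mono)
  also have "\<dots> \<le> (\<Sum>d | d dvd n \<and> d \<ge> 2. card ((#) d ` G (n div d)))"
    using fin by (rule card_UN_le)
  also have "\<dots> \<le> (\<Sum>d | d dvd n \<and> d \<ge> 2. card (G (n div d)))"
    by (intro sum_mono card_image_le finG)
  also have "\<dots> = (\<Sum>d | d dvd n \<and> d \<ge> 2. kalmar_K (n div d))"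
    using assms by (intro sum.cong refl K) (auto dest: dvd_imp_le simp: div_greater_zero_iff)
  finally show ?thesis .
qed

text \<open>
  Rankin's method: any submultiplicative weight \<open>f\<close> whose values on the divisors \<open>d \<ge> 2\<close> of \<open>N\<close> sum to at
  most 1 can replace \<open>n\<^sup>-\<^sup>\<rho>\<close>. By induction over the divisors \<open>n\<close> of \<open>N\<close>,
  \<open>K(n) \<le> \<Sum> K(n/d) \<le> \<Sum> 1/f(n/d) \<le> (\<Sum> f(d)) / f(n)\<close>.
\<close>
lemma kalmar_K_upper:
  fixes f :: "nat \<Rightarrow> real"
  assumes N: "N > 0"
    and pos: "\<And>n. n > 0 \<Longrightarrow> f n > 0" and f1: "f 1 \<le> 1"
    and sub: "\<And>m n. m > 0 \<Longrightarrow> n > 0 \<Longrightarrow> f (m * n) \<le> f m * f n"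
    and le1: "(\<Sum>d | d dvd N \<and> d \<ge> 2. f d) \<le> 1"
  shows "real (kalmar_K N) \<le> 1 / f N"
proof -
  have fin: "finite {d. d dvd N \<and> d \<ge> 2}"
    using N by (intro finite_subset[OF _ finite_divisors_nat[of N]]) auto
  have "real (kalmar_K n) \<le> 1 / f n" if "n dvd N" for n
    using that
  proof (induction n rule: less_induct)
    case (less n)
    have n0: "n > 0" using less N by (auto intro: dvd_pos_nat)
    show ?case
    proof (cases "n = 1")
      case True
      thus ?thesis using f1 pos[of 1] by (simp add: kalmar_K_def)
    next
      case False
      hence n2: "n \<ge> 2" using n0 by auto
      have "real (kalmar_K n) \<le> (\<Sum>d | d dvd n \<and> d \<ge> 2. real (kalmar_K (n div d)))"
        using kalmar_K_le_sum[OF n2] by (simp flip: of_nat_sum)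
      also have "\<dots> \<le> (\<Sum>d | d dvd n \<and> d \<ge> 2. f d / f n)"
      proof (rule sum_mono)
        fix d assume d: "d \<in> {d. d dvd n \<and> d \<ge> 2}"
        then obtain e where e: "n = d * e" by auto
        hence e0: "e > 0" "d > 0" using n0 by auto
        have "real (kalmar_K (n div d)) \<le> 1 / f e"
          using less.IH[of e] less.prems e d e0 by (auto intro: dvd_mult_right)
        also have "\<dots> \<le> f d / f n"
          using sub[OF e0(2,1)] pos[OF e0(1)] pos[OF n0] e by (simp add: field_simps)
        finally show "real (kalmar_K (n div d)) \<le> f d / f n" .
      qed
      also have "\<dots> = (\<Sum>d | d dvd n \<and> d \<ge> 2. f d) / f n"
        by (simp add: sum_divide_distrib)
      also have "(\<Sum>d | d dvd n \<and> d \<ge> 2. f d) \<le> (\<Sum>d | d dvd N \<and> d \<ge> 2. f d)"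
        using less.prems fin pos by (intro sum_mono2) (auto intro: dvd_trans less_imp_le)
      also note le1
      finally show ?thesis using pos[OF n0] by (simp add: divide_right_mono)
    qed
  qed
  thus ?thesis by simp
qed

section \<open>Two upper bounds in terms of the prime divisors\<close>

lemma sum_multiples_le:
  fixes F :: "nat \<Rightarrow> real"
  assumes "d > 0" "\<And>n. F n \<ge> 0"
  shows "(\<Sum>n | n \<in> {0<..X} \<and> d dvd n. F n) \<le> (\<Sum>m\<in>{0<..X}. F (d * m))"
proof -
  have "{n. n \<in> {0<..X} \<and> d dvd n} \<subseteq> (*) d ` {0<..X}"
  proof
    fix n assume "n \<in> {n. n \<in> {0<..X} \<and> d dvd n}"
    then obtain k where k: "n = d * k" and "d * k \<le> X" "k > 0" by (auto elim!: dvdE)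
    moreover have "k \<le> d * k" using assms(1) by simp
    ultimately have "k \<in> {0<..X}" by (metis greaterThanAtMost_iff le_trans)
    thus "n \<in> (*) d ` {0<..X}" unfolding k by blast
  qed
  hence "(\<Sum>n | n \<in> {0<..X} \<and> d dvd n. F n) \<le> (\<Sum>n\<in>(*) d ` {0<..X}. F n)"
    using assms by (intro sum_mono2) auto
  also have "\<dots> = (\<Sum>m\<in>{0<..X}. F (d * m))"
    using assms by (subst sum.reindex) (auto simp: inj_on_def)
  finally show ?thesis .
qed

lemma sum_powr_rho_le_2: "(\<Sum>n\<in>{0<..X}. real n powr -rho) \<le> 2"
  using sum_powr_le_zeta[of rho "{0<..X}"] rho_props by simp

text \<open>
  Adding a prime \<open>q\<close> to \<open>P\<close> doubles the terms with \<open>q dvd n\<close>. Writing \<open>n = q m\<close>, the extra terms are at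
  most \<open>q\<^sup>-\<^sup>\<rho>\<close> times the previous sum, because the other primes of \<open>P\<close> divide \<open>q m\<close> exactly when they
  divide \<open>m\<close>.
\<close>
lemma sum_powr_prime_weight_le:
  assumes "finite P" "\<And>p. p \<in> P \<Longrightarrow> prime p"
  shows "(\<Sum>n\<in>{0<..X}. real n powr -rho * 2 ^ card {p\<in>P. p dvd n})
           \<le> 2 * (\<Prod>p\<in>P. 1 + real p powr -rho)"
  using assms
proof (induction P)
  case empty
  thus ?case using sum_powr_rho_le_2[of X] by simp
next
  case (insert q P)
  define c where "c = (\<lambda>n. card {p\<in>P. p dvd n})"
  have q: "prime q" "q > 0" using insert.prems prime_gt_0_nat by auto
  have c': "card {p\<in>insert q P. p dvd n} = (if q dvd n then Suc (c n) else c n)" for n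
  proof -
    have "{p\<in>insert q P. p dvd n} = (if q dvd n then insert q {p\<in>P. p dvd n} else {p\<in>P. p dvd n})"
      by auto
    thus ?thesis using insert.hyps by (simp add: c_def)
  qed
  have cq: "c (q * m) = c m" for m
  proof -
    have "p dvd q * m \<longleftrightarrow> p dvd m" if "p \<in> P" for p
      using that insert.prems insert.hyps(2) q primes_dvd_imp_eq[of p q]
      by (auto simp: prime_dvd_mult_iff)
    hence "{p\<in>P. p dvd q * m} = {p\<in>P. p dvd m}" by blast
    thus ?thesis by (simp add: c_def)
  qed
  let ?A = "\<Sum>n\<in>{0<..X}. real n powr -rho * 2 ^ c n"
  have "(\<Sum>n\<in>{0<..X}. real n powr -rho * 2 ^ card {p\<in>insert q P. p dvd n})
      = (\<Sum>n\<in>{0<..X}. real n powr -rho * 2 ^ c n + (if q dvd n then real n powr -rho * 2 ^ c n else 0))"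
    unfolding c' by (intro sum.cong) auto
  also have "\<dots> = ?A + (\<Sum>n | n \<in> {0<..X} \<and> q dvd n. real n powr -rho * 2 ^ c n)"
    using sum.inter_filter[of "{0<..X}" "\<lambda>n. real n powr -rho * 2 ^ c n" "\<lambda>n. q dvd n"]
    by (simp add: sum.distrib)
  also have "(\<Sum>n | n \<in> {0<..X} \<and> q dvd n. real n powr -rho * 2 ^ c n)
      \<le> (\<Sum>m\<in>{0<..X}. real (q * m) powr -rho * 2 ^ c (q * m))"
    using q by (intro sum_multiples_le) auto
  also have "\<dots> = real q powr -rho * ?A"
    unfolding cq sum_distrib_left by (intro sum.cong) (auto simp: powr_mult)
  also have "?A + real q powr -rho * ?A = ?A * (1 + real q powr -rho)"
    by (simp add: algebra_simps)
  also have "\<dots> \<le> (2 * (\<Prod>p\<in>P. 1 + real p powr -rho)) * (1 + real q powr -rho)"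
    using insert by (intro mult_right_mono) (auto simp: c_def)
  finally show ?case using insert.hyps by (simp add: mult_ac)
qed

text \<open>
  Doubling the weight of a letter for each prime of \<open>P\<close> that divides it multiplies \<open>\<zeta>(\<rho>)\<close> by at most
  \<open>exp E\<close>, \<open>E\<close> the sum of \<open>p\<^sup>-\<^sup>\<rho>\<close> over \<open>P\<close>. Raising the exponent by \<open>\<delta>\<close> multiplies the mass of the
  letters \<open>n \<ge> 2\<close> by at most \<open>2\<^sup>-\<^sup>\<delta>\<close>; so \<open>\<delta> = 2 E / ln 2\<close> compensates, thanks to \<open>2 e\<^sup>E - 1 \<le> e\<^sup>2\<^sup>E\<close>.
\<close>
lemma ln_kalmar_K_le_of_prime_divisors:
  assumes N: "N > 0" and P: "finite P" "\<And>p. p \<in> P \<Longrightarrow> prime p" "\<And>p. p \<in> P \<Longrightarrow> p dvd N"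
  shows "ln (real (kalmar_K N)) \<le> (rho + 2 / ln 2 * (\<Sum>p\<in>P. real p powr -rho)) * ln (real N)
             - real (card P) * ln 2"
proof -
  define E where "E = (\<Sum>p\<in>P. real p powr -rho)"
  define d where "d = 2 / ln 2 * E"
  define c where "c = (\<lambda>n. card {p\<in>P. p dvd n})"
  define f where "f = (\<lambda>n. real n powr -(rho + d) * 2 ^ c n)"
  have E: "E \<ge> 0" unfolding E_def by (intro sum_nonneg) auto
  have d0: "d \<ge> 0" using E by (simp add: d_def)
  have c_mult: "c (m * n) \<le> c m + c n" for m n
  proof -
    have "{p\<in>P. p dvd m * n} \<subseteq> {p\<in>P. p dvd m} \<union> {p\<in>P. p dvd n}"
      using P(2) by (auto simp: prime_dvd_mult_iff)
    hence "c (m * n) \<le> card ({p\<in>P. p dvd m} \<union> {p\<in>P. p dvd n})"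
      unfolding c_def using P(1) by (intro card_mono) auto
    thus ?thesis unfolding c_def using card_Un_le le_trans by blast
  qed
  have c1: "c 1 = 0"
  proof -
    have "{p\<in>P. p dvd 1} = {}" using P(2)[of 1] by auto
    thus ?thesis unfolding c_def by (metis card.empty)
  qed
  have "real (kalmar_K N) \<le> 1 / f N"
  proof (rule kalmar_K_upper[OF N])
    show "f 1 \<le> 1" using c1 by (simp add: f_def)
    show "f n > 0" if "n > 0" for n using that by (simp add: f_def)
    show "f (m * n) \<le> f m * f n" if "m > 0" "n > 0" for m n
    proof -
      have "(2::real) ^ c (m * n) \<le> 2 ^ (c m + c n)"
        using c_mult by (intro power_increasing) auto
      hence "real (m * n) powr -(rho + d) * 2 ^ c (m * n) \<le> real (m * n) powr -(rho + d) * 2 ^ (c m + c n)"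
        by (intro mult_left_mono) auto
      thus ?thesis using that by (simp add: f_def powr_mult power_add mult_ac)
    qed
    have sub: "{d. d dvd N \<and> d \<ge> 2} \<subseteq> {1<..N}" using N by (auto dest: dvd_imp_le)
    have "(\<Sum>d | d dvd N \<and> d \<ge> 2. f d) \<le> (\<Sum>n\<in>{1<..N}. f n)"
      using sub by (intro sum_mono2) (auto simp: f_def)
    also have "\<dots> \<le> (\<Sum>n\<in>{1<..N}. 2 powr -d * (real n powr -rho * 2 ^ c n))"
    proof (intro sum_mono)
      fix n assume n: "n \<in> {1<..N}"
      have "-(rho + d) = -d + -rho" by simp
      hence "real n powr -(rho + d) = real n powr -d * real n powr -rho"
        by (simp only: powr_add)
      also have "\<dots> \<le> 2 powr -d * real n powr -rho"
        using n d0 by (intro mult_right_mono powr_mono2') auto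
      finally have "real n powr -(rho + d) * 2 ^ c n \<le> (2 powr -d * real n powr -rho) * 2 ^ c n"
        by (intro mult_right_mono) auto
      thus "f n \<le> 2 powr -d * (real n powr -rho * 2 ^ c n)"
        by (simp add: f_def mult.assoc)
    qed
    also have "\<dots> = 2 powr -d * (\<Sum>n\<in>{1<..N}. real n powr -rho * 2 ^ c n)"
      by (simp add: sum_distrib_left)
    also have "\<dots> \<le> 2 powr -d * (exp (2 * E))"
    proof (intro mult_left_mono)
      have "{0<..N} = insert 1 {1<..N}" using N by auto
      hence "(\<Sum>n\<in>{1<..N}. real n powr -rho * 2 ^ c n)
          = (\<Sum>n\<in>{0<..N}. real n powr -rho * 2 ^ c n) - 1"
        using c1 by simp
      also have "\<dots> \<le> 2 * (\<Prod>p\<in>P. 1 + real p powr -rho) - 1"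
        using sum_powr_prime_weight_le[OF P(1,2), of N] by (simp add: c_def)
      also have "(\<Prod>p\<in>P. 1 + real p powr -rho) \<le> (\<Prod>p\<in>P. exp (real p powr -rho))"
        by (intro prod_mono) auto
      also have "\<dots> = exp E" using P(1) by (simp add: E_def exp_sum)
      also have "2 * exp E - 1 \<le> exp (2 * E)"
        using zero_le_power2[of "exp E - 1"] by (simp add: power2_eq_square algebra_simps flip: exp_add)
      finally show "(\<Sum>n\<in>{1<..N}. real n powr -rho * 2 ^ c n) \<le> exp (2 * E)" by simp
    qed auto
    also have "2 powr -d * exp (2 * E) = 1"
      by (simp add: powr_def d_def flip: exp_add)
    finally show "(\<Sum>d | d dvd N \<and> d \<ge> 2. f d) \<le> 1" .
  qed
  moreover have "c N = card P"
    unfolding c_def by (rule arg_cong[of _ _ card]) (use P(3) in auto)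
  ultimately have "real (kalmar_K N) \<le> 1 / (real N powr -(rho + d) * 2 ^ card P)"
    by (simp add: f_def)
  hence "ln (real (kalmar_K N)) \<le> ln (1 / (real N powr -(rho + d) * 2 ^ card P))"
    using N kalmar_K_pos[OF N] by (subst ln_le_cancel_iff) auto
  also have "\<dots> = (rho + d) * ln (real N) - real (card P) * ln 2"
    using N by (simp add: ln_div ln_mult ln_powr ln_realpow algebra_simps)
  finally show ?thesis by (simp add: d_def E_def)
qed

text \<open>
  Primes not dividing \<open>N\<close> are not letters, so the divisors \<open>d \<ge> 2\<close> of \<open>N\<close> have mass at most \<open>1 - E\<close>, with
  \<open>E\<close> the sum of \<open>p\<^sup>-\<^sup>\<rho>\<close> over \<open>Q\<close>. The mass is a convex function of the exponent, and it is still finite at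
  the exponent midway between 1 and \<open>\<rho>\<close>; hence the exponent can be lowered from \<open>\<rho>\<close> by a constant
  times \<open>E\<close> before the mass reaches 1.
\<close>
lemma ln_kalmar_K_le_of_missing_primes:
  "\<exists>C>0. \<forall>N>0. \<forall>Q. finite Q \<longrightarrow> (\<forall>p\<in>Q. prime p \<and> \<not> p dvd N) \<longrightarrow>
     ln (real (kalmar_K N)) \<le> (rho - C * (\<Sum>p\<in>Q. real p powr -rho)) * ln (real N)"
proof -
  define d0 where "d0 = (rho - 1) / 2"
  have d0: "d0 > 0" "rho - d0 > 1" using rho_props by (auto simp: d0_def field_simps)
  define B where "B = real_zeta (rho - d0)"
  have B: "B \<ge> 1" using sum_powr_le_zeta[OF d0(2), of "{1}"] by (simp add: B_def)
  show ?thesis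
  proof (intro exI[of _ "d0 / B"] conjI allI impI)
    show "d0 / B > 0" using d0 B by simp
    fix N :: nat and Q :: "nat set"
    assume N: "N > 0" and Q: "finite Q" "\<forall>p\<in>Q. prime p \<and> \<not> p dvd N"
    define E where "E = (\<Sum>p\<in>Q. real p powr -rho)"
    define t where "t = E / B"
    define s where "s = rho - t * d0"
    define D where "D = {d. d dvd N \<and> d \<ge> 2}"
    have E0: "E \<ge> 0" unfolding E_def by (intro sum_nonneg) auto
    have E1: "E \<le> 1" unfolding E_def
      using Q by (intro sum_powr_rho_le_1) (auto dest: prime_ge_2_nat)
    have t: "t \<ge> 0" "t \<le> 1" using E0 E1 B by (auto simp: t_def field_simps)
    have finD: "finite D" using N unfolding D_def
      by (intro finite_subset[OF _ finite_divisors_nat[of N]]) auto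
    have "real (kalmar_K N) \<le> 1 / (real N powr -s)"
    proof (rule kalmar_K_upper[OF N])
      have "(\<Sum>d\<in>D. real d powr -s) \<le> (\<Sum>d\<in>D. real d powr -rho + t * real d powr -(rho - d0))"
      proof (rule sum_mono)
        fix d assume "d \<in> D"
        hence d: "d \<ge> 2" by (auto simp: D_def)
        \<comment> \<open>convexity of \<open>exp\<close>: the chord from exponent 0 to \<open>d0\<close> lies above the graph\<close>
        have "(real d powr d0) powr t * 1 powr (1 - t) \<le> t * real d powr d0 + (1 - t) * 1"
          using t d by (intro Youngs_inequality_0) auto
        hence "real d powr (t * d0) \<le> 1 + t * real d powr d0"
          using t d by (simp add: powr_powr mult.commute)
        hence "real d powr -rho * real d powr (t * d0) \<le> real d powr -rho * (1 + t * real d powr d0)"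
          by (intro mult_left_mono) auto
        also have "real d powr -rho * real d powr (t * d0) = real d powr -s"
          by (simp add: s_def flip: powr_add)
        also have "real d powr -rho * (1 + t * real d powr d0) = real d powr -rho + t * real d powr -(rho - d0)"
          by (simp add: algebra_simps flip: powr_add)
        finally show "real d powr -s \<le> real d powr -rho + t * real d powr -(rho - d0)" .
      qed
      also have "\<dots> = (\<Sum>d\<in>D. real d powr -rho) + t * (\<Sum>d\<in>D. real d powr -(rho - d0))"
        by (simp add: sum.distrib sum_distrib_left)
      also have "(\<Sum>d\<in>D. real d powr -rho) \<le> 1 - E"
      proof -
        have "(\<Sum>d\<in>D \<union> Q. real d powr -rho) \<le> 1"
          using Q finD by (intro sum_powr_rho_le_1) (auto simp: D_def dest: prime_ge_2_nat)
        moreover have "(\<Sum>d\<in>D \<union> Q. real d powr -rho) = (\<Sum>d\<in>D. real d powr -rho) + E"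
          unfolding E_def using Q finD by (intro sum.union_disjoint) (auto simp: D_def)
        ultimately show ?thesis by simp
      qed
      also have "t * (\<Sum>d\<in>D. real d powr -(rho - d0)) \<le> t * B"
        unfolding B_def using t d0 finD by (intro mult_left_mono sum_powr_le_zeta) (auto simp: D_def)
      also have "1 - E + t * B = 1" using B by (simp add: t_def)
      finally show "(\<Sum>d | d dvd N \<and> d \<ge> 2. real d powr -s) \<le> 1" by (simp add: D_def)
    qed (auto simp: powr_mult)
    hence "ln (real (kalmar_K N)) \<le> ln (1 / (real N powr -s))"
      using N kalmar_K_pos[OF N] by (subst ln_le_cancel_iff) auto
    also have "\<dots> = s * ln (real N)" using N by (simp add: ln_div ln_powr)
    finally show "ln (real (kalmar_K N)) \<le> (rho - d0 / B * (\<Sum>p\<in>Q. real p powr -rho)) * ln (real N)"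
      by (simp add: s_def t_def E_def mult_ac)
  qed
qed

section \<open>Random words and lattice points\<close>

definition words :: "'a set \<Rightarrow> nat \<Rightarrow> 'a list set" where
  "words S r = {xs. set xs \<subseteq> S \<and> length xs = r}"

lemma finite_words: "finite S \<Longrightarrow> finite (words S r)"
  unfolding words_def by (rule finite_lists_length_eq)

lemma sum_words_Suc:
  "(\<Sum>xs\<in>words S (Suc r). F xs) = (\<Sum>x\<in>S. \<Sum>xs\<in>words S r. F (x # xs))"
proof -
  have "words S (Suc r) = (\<lambda>(x, xs). x # xs) ` (S \<times> words S r)"
    by (force simp: words_def length_Suc_conv)
  hence "(\<Sum>xs\<in>words S (Suc r). F xs) = (\<Sum>z\<in>S \<times> words S r. F (fst z # snd z))"
    by (simp add: sum.reindex inj_on_def case_prod_unfold)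
  thus ?thesis by (simp add: sum.cartesian_product case_prod_unfold)
qed

lemma sum_words_weight:
  fixes q :: "'a \<Rightarrow> real"
  assumes "(\<Sum>x\<in>S. q x) = 1"
  shows "(\<Sum>xs\<in>words S r. prod_list (map q xs)) = 1"
proof (induction r)
  case 0
  have "words S 0 = {[]}" by (auto simp: words_def)
  thus ?case by simp
next
  case (Suc r)
  thus ?case by (simp add: sum_words_Suc assms flip: sum_distrib_left)
qed

lemma words_centered_moments:
  fixes q h :: "'a \<Rightarrow> real"
  assumes q: "(\<Sum>x\<in>S. q x) = 1" and h: "(\<Sum>x\<in>S. q x * h x) = 0"
  shows "(\<Sum>xs\<in>words S r. prod_list (map q xs) * sum_list (map h xs)) = 0"
    and "(\<Sum>xs\<in>words S r. prod_list (map q xs) * (sum_list (map h xs))\<^sup>2) = real r * (\<Sum>x\<in>S. q x * (h x)\<^sup>2)"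
proof (induction r)
  case 0
  have "words S 0 = {[]}" by (auto simp: words_def)
  thus "(\<Sum>xs\<in>words S 0. prod_list (map q xs) * sum_list (map h xs)) = 0"
    "(\<Sum>xs\<in>words S 0. prod_list (map q xs) * (sum_list (map h xs))\<^sup>2) = real 0 * (\<Sum>x\<in>S. q x * (h x)\<^sup>2)"
    by simp_all
next
  case (Suc r)
  let ?w = "\<lambda>xs. prod_list (map q xs)" and ?H = "\<lambda>xs. sum_list (map h xs)"
  let ?W = "words S r"
  have 1: "(\<Sum>xs\<in>?W. ?w xs) = 1" by (rule sum_words_weight[OF q])
  have "(\<Sum>xs\<in>words S (Suc r). ?w xs * ?H xs)
      = (\<Sum>x\<in>S. q x * h x * (\<Sum>xs\<in>?W. ?w xs) + q x * (\<Sum>xs\<in>?W. ?w xs * ?H xs))"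
    unfolding sum_words_Suc by (simp add: sum_distrib_left sum.distrib algebra_simps)
  thus "(\<Sum>xs\<in>words S (Suc r). ?w xs * ?H xs) = 0"
    using Suc.IH(1) h 1 by simp
  have "(\<Sum>xs\<in>words S (Suc r). ?w xs * (?H xs)\<^sup>2)
      = (\<Sum>x\<in>S. q x * (h x)\<^sup>2 * (\<Sum>xs\<in>?W. ?w xs) + 2 * (q x * h x) * (\<Sum>xs\<in>?W. ?w xs * ?H xs)
           + q x * (\<Sum>xs\<in>?W. ?w xs * (?H xs)\<^sup>2))"
    unfolding sum_words_Suc
    by (simp add: sum_distrib_left sum.distrib algebra_simps power2_eq_square)
  also have "\<dots> = (\<Sum>x\<in>S. q x * (h x)\<^sup>2) + (\<Sum>x\<in>S. q x) * (real r * (\<Sum>x\<in>S. q x * (h x)\<^sup>2))"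
    unfolding Suc.IH 1 by (simp add: sum.distrib sum_distrib_right)
  finally show "(\<Sum>xs\<in>words S (Suc r). ?w xs * (?H xs)\<^sup>2) = real (Suc r) * (\<Sum>x\<in>S. q x * (h x)\<^sup>2)"
    unfolding q by (simp add: algebra_simps)
qed

text \<open>
  Words of independent letters: the variance of a sum of \<open>r\<close> independent terms is \<open>r\<close> times the variance of
  one term, and that is at most its second moment.
\<close>
lemma words_variance_le:
  fixes q h :: "'a \<Rightarrow> real"
  assumes q: "(\<Sum>x\<in>S. q x) = 1" and e: "e = (\<Sum>x\<in>S. q x * h x)"
  shows "(\<Sum>xs\<in>words S r. prod_list (map q xs) * (sum_list (map h xs) - real r * e)\<^sup>2)
           \<le> real r * (\<Sum>x\<in>S. q x * (h x)\<^sup>2)"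
proof -
  let ?g = "\<lambda>x. h x - e"
  have "(\<Sum>x\<in>S. q x * ?g x) = (\<Sum>x\<in>S. q x * h x) - e * (\<Sum>x\<in>S. q x)"
    by (simp add: algebra_simps sum_subtractf sum_distrib_left)
  hence c: "(\<Sum>x\<in>S. q x * ?g x) = 0" using q e by simp
  have "sum_list (map ?g xs) = sum_list (map h xs) - real r * e" if "xs \<in> words S r" for xs
  proof -
    have "sum_list (map ?g xs) = sum_list (map h xs) - real (length xs) * e"
      by (induction xs) (auto simp: algebra_simps)
    thus ?thesis using that by (simp add: words_def)
  qed
  hence "(\<Sum>xs\<in>words S r. prod_list (map q xs) * (sum_list (map h xs) - real r * e)\<^sup>2)
      = (\<Sum>xs\<in>words S r. prod_list (map q xs) * (sum_list (map ?g xs))\<^sup>2)"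
    by (intro sum.cong) auto
  also have "\<dots> = real r * (\<Sum>x\<in>S. q x * (?g x)\<^sup>2)" by (rule words_centered_moments(2)[OF q c])
  also have "(\<Sum>x\<in>S. q x * (?g x)\<^sup>2)
      = (\<Sum>x\<in>S. q x * (h x)\<^sup>2) - 2 * e * (\<Sum>x\<in>S. q x * h x) + e\<^sup>2 * (\<Sum>x\<in>S. q x)"
    by (simp add: power2_eq_square algebra_simps sum_subtractf sum.distrib sum_distrib_left)
  also have "\<dots> = (\<Sum>x\<in>S. q x * (h x)\<^sup>2) - e\<^sup>2" using q e by (simp add: power2_eq_square)
  finally show ?thesis by (simp add: mult_left_mono)
qed

lemma sum_geometric_subset_le:
  fixes x :: real
  assumes "0 \<le> x" "x < 1" "finite B"
  shows "(\<Sum>j\<in>B. x ^ j) \<le> 1 / (1 - x)"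
proof -
  have "(\<Sum>j\<in>B. x ^ j) \<le> (\<Sum>j. x ^ j)"
    using assms by (intro sum_le_suminf summable_geometric) auto
  thus ?thesis using assms by (simp add: suminf_geometric)
qed

text \<open>
  Both sides of \<open>c\<close> give a geometric series with ratio \<open>exp (-1/s)\<close>, and \<open>1 / (1 - exp (-1/s)) \<le> 1 + s\<close>.
\<close>
lemma sum_exp_neg_abs_le:
  fixes c s :: real
  assumes s: "s > 0" and A: "finite (A :: nat set)"
  shows "(\<Sum>a\<in>A. exp (-(\<bar>real a - c\<bar> / s))) \<le> 2 * (1 + s)"
proof -
  define x where "x = exp (-1/s)"
  have x: "0 \<le> x" "x < 1" using s by (auto simp: x_def)
  have "1 + 1/s \<le> exp (1/s)" by (rule exp_ge_add_one_self)
  hence "x \<le> 1 / (1 + 1/s)"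
    using s by (simp add: x_def exp_minus field_simps)
  also have "\<dots> = 1 - 1 / (1 + s)" using s by (simp add: field_simps)
  finally have "1 / (1 + s) \<le> 1 - x" by simp
  hence gs: "1 / (1 - x) \<le> 1 + s" using s x by (simp add: field_simps)
  have pw: "x ^ k = exp (- (real k / s))" for k
    by (simp add: x_def flip: exp_of_nat_mult)
  let ?e = "\<lambda>a. exp (-(\<bar>real a - c\<bar> / s))"
  have lo: "(\<Sum>a | a \<in> A \<and> real a \<le> c. ?e a) \<le> 1 + s"
  proof -
    define n where "n = nat \<lfloor>c\<rfloor>"
    have n: "a \<le> n" "real n \<le> c" if "real a \<le> c" for a
      using that by (auto simp: n_def le_nat_iff le_floor_iff of_nat_floor)
    have "(\<Sum>a | a \<in> A \<and> real a \<le> c. ?e a) \<le> (\<Sum>a | a \<in> A \<and> real a \<le> c. x ^ (n - a))"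
    proof (rule sum_mono)
      fix a assume a: "a \<in> {a. a \<in> A \<and> real a \<le> c}"
      hence "real (n - a) \<le> \<bar>real a - c\<bar>" using n[of a] by (simp add: of_nat_diff)
      thus "?e a \<le> x ^ (n - a)" unfolding pw using s by (simp add: divide_right_mono)
    qed
    also have "\<dots> = (\<Sum>j\<in>(\<lambda>a. n - a) ` {a. a \<in> A \<and> real a \<le> c}. x ^ j)"
    proof (subst sum.reindex)
      show "inj_on (\<lambda>a. n - a) {a \<in> A. real a \<le> c}"
        by (rule inj_onI) (metis (mono_tags, lifting) diff_diff_cancel mem_Collect_eq n(1))
    qed auto
    also have "\<dots> \<le> 1 / (1 - x)" using x A by (intro sum_geometric_subset_le) auto
    finally show ?thesis using gs by linarith
  qed
  have hi: "(\<Sum>a | a \<in> A \<and> \<not> real a \<le> c. ?e a) \<le> 1 + s"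
  proof -
    define n where "n = nat \<lceil>c\<rceil>"
    have n: "n \<le> a" "c \<le> real n" if "\<not> real a \<le> c" for a
      using that by (auto simp: n_def nat_le_iff ceiling_le_iff real_nat_ceiling_ge)
    have "(\<Sum>a | a \<in> A \<and> \<not> real a \<le> c. ?e a) \<le> (\<Sum>a | a \<in> A \<and> \<not> real a \<le> c. x ^ (a - n))"
    proof (rule sum_mono)
      fix a assume a: "a \<in> {a. a \<in> A \<and> \<not> real a \<le> c}"
      hence "real (a - n) \<le> \<bar>real a - c\<bar>" using n[of a] by (simp add: of_nat_diff)
      thus "?e a \<le> x ^ (a - n)" unfolding pw using s by (simp add: divide_right_mono)
    qed
    also have "\<dots> = (\<Sum>j\<in>(\<lambda>a. a - n) ` {a. a \<in> A \<and> \<not> real a \<le> c}. x ^ j)"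
    proof (subst sum.reindex)
      show "inj_on (\<lambda>a. a - n) {a \<in> A. \<not> real a \<le> c}"
        by (rule inj_onI) (metis (mono_tags, lifting) le_add_diff_inverse mem_Collect_eq n(1))
    qed auto
    also have "\<dots> \<le> 1 / (1 - x)" using x A by (intro sum_geometric_subset_le) auto
    finally show ?thesis using gs by linarith
  qed
  have "A = {a. a \<in> A \<and> real a \<le> c} \<union> {a. a \<in> A \<and> \<not> real a \<le> c}" by blast
  hence eq: "(\<Sum>a\<in>A. ?e a) = (\<Sum>a | a \<in> A \<and> real a \<le> c. ?e a) + (\<Sum>a | a \<in> A \<and> \<not> real a \<le> c. ?e a)"
    using A by (subst sum.union_disjoint[symmetric]) (auto intro: finite_subset[OF _ A])
  have "(\<Sum>a\<in>A. ?e a) \<le> (1 + s) + (1 + s)"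
    unfolding eq by (rule add_mono[OF lo hi])
  thus ?thesis by simp
qed

text \<open>
  Count with weights: on \<open>G\<close> the function \<open>exp (B - \<Sum> \<bar>v m p - c p\<bar> / s p)\<close> is at least 1, and its sum over
  all exponent vectors factors over \<open>p\<close>. Only the average of the relative deviations is bounded, not each
  of them: a bound \<open>O(s p)\<close> for all coordinates at once could not be guaranteed with probability \<open>1/2\<close>.
\<close>
lemma card_lattice_points_le:
  fixes v :: "'b \<Rightarrow> 'a \<Rightarrow> nat" and c s :: "'a \<Rightarrow> real"
  assumes P: "finite P" and G: "finite G" and s: "\<And>p. p \<in> P \<Longrightarrow> s p > 0"
    and inj: "\<And>m n. m \<in> G \<Longrightarrow> n \<in> G \<Longrightarrow> (\<And>p. p \<in> P \<Longrightarrow> v m p = v n p) \<Longrightarrow> m = n"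
    and B: "\<And>m. m \<in> G \<Longrightarrow> (\<Sum>p\<in>P. \<bar>real (v m p) - c p\<bar> / s p) \<le> B"
  shows "real (card G) \<le> exp B * (\<Prod>p\<in>P. 2 * (1 + s p))"
proof -
  define e where "e = (\<lambda>p a. exp (-(\<bar>real a - c p\<bar> / s p)))"
  define \<phi> where "\<phi> = (\<lambda>m. restrict (v m) P)"
  define T where "T = (\<lambda>p. (\<lambda>m. v m p) ` G)"
  have \<phi>: "inj_on \<phi> G"
    by (rule inj_onI, rule inj) (auto simp: \<phi>_def dest: fun_cong split: if_splits | metis restrict_apply')+
  have finT: "finite (T p)" for p using G by (simp add: T_def)
  have finPiE: "finite (PiE P T)" by (intro finite_PiE P finT)
  have "real (card G) = (\<Sum>m\<in>G. 1)" by simp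
  also have "\<dots> \<le> (\<Sum>m\<in>G. exp B * (\<Prod>p\<in>P. e p (v m p)))"
  proof (rule sum_mono)
    fix m assume m: "m \<in> G"
    have "(\<Prod>p\<in>P. e p (v m p)) = exp (- (\<Sum>p\<in>P. \<bar>real (v m p) - c p\<bar> / s p))"
      unfolding e_def by (subst exp_sum[OF P, symmetric]) (simp add: sum_negf)
    hence "exp B * (\<Prod>p\<in>P. e p (v m p)) = exp (B - (\<Sum>p\<in>P. \<bar>real (v m p) - c p\<bar> / s p))"
      by (simp flip: exp_add)
    thus "1 \<le> exp B * (\<Prod>p\<in>P. e p (v m p))" using B[OF m] by simp
  qed
  also have "\<dots> = exp B * (\<Sum>m\<in>G. \<Prod>p\<in>P. e p (v m p))" by (simp add: sum_distrib_left)
  also have "(\<Sum>m\<in>G. \<Prod>p\<in>P. e p (v m p)) = (\<Sum>g\<in>\<phi> ` G. \<Prod>p\<in>P. e p (g p))"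
    unfolding sum.reindex[OF \<phi>] by (simp add: \<phi>_def)
  also have "\<dots> \<le> (\<Sum>g\<in>PiE P T. \<Prod>p\<in>P. e p (g p))"
    using finPiE by (intro sum_mono2) (auto simp: \<phi>_def T_def e_def intro!: prod_nonneg)
  also have "\<dots> = (\<Prod>p\<in>P. \<Sum>a\<in>T p. e p a)"
    using P finT by (intro prod_sum_PiE[symmetric]) auto
  also have "\<dots> \<le> (\<Prod>p\<in>P. 2 * (1 + s p))"
    using sum_exp_neg_abs_le[OF s finT] by (intro prod_mono) (auto simp: e_def intro: sum_nonneg)
  finally show ?thesis by simp
qed

section \<open>A large value of K among the products of typical words\<close>

lemma multiplicity_prod_list:
  fixes xs :: "nat list"
  assumes "prime p" "0 \<notin> set xs"
  shows "multiplicity p (prod_list xs) = sum_list (map (multiplicity p) xs)"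
  using assms(2)
proof (induction xs)
  case (Cons x xs)
  thus ?case using assms(1)
    by (simp add: prime_elem_multiplicity_mult_distrib prod_list_zero_iff)
qed auto

lemma ln_prod_list:
  fixes xs :: "nat list"
  assumes "0 \<notin> set xs"
  shows "ln (real (prod_list xs)) = sum_list (map (\<lambda>x. ln (real x)) xs)"
  using assms
proof (induction xs)
  case (Cons x xs)
  thus ?case by (simp add: ln_mult prod_list_zero_iff)
qed auto

lemma smooth_eqI:
  fixes m n :: nat
  assumes "m > 0" "n > 0" "prime_factors m \<subseteq> P" "prime_factors n \<subseteq> P"
    and "\<And>p. p \<in> P \<Longrightarrow> prime p" "\<And>p. p \<in> P \<Longrightarrow> multiplicity p m = multiplicity p n"
  shows "m = n"
proof (rule multiplicity_eq_nat)
  fix p :: nat assume p: "prime p"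
  show "multiplicity p m = multiplicity p n"
  proof (cases "p \<in> P")
    case False
    hence "\<not> p dvd m" "\<not> p dvd n" using assms p by (auto simp: in_prime_factors_iff)
    thus ?thesis by (simp add: not_dvd_imp_multiplicity_0)
  qed (use assms in auto)
qed (use assms in auto)

lemma weight_powr:
  fixes xs :: "nat list"
  assumes "0 \<notin> set xs"
  shows "prod_list (map (\<lambda>x. real x powr -s / Z) xs) = real (prod_list xs) powr -s / Z ^ length xs"
  using assms by (induction xs) (auto simp: powr_mult)

lemma card_words_le_kalmar_K:
  assumes "r \<ge> 1" "\<And>x. x \<in> S \<Longrightarrow> x \<ge> 2" "m \<noteq> 1"
  shows "card {xs \<in> words S r. prod_list xs = m} \<le> kalmar_K m"
proof -
  have "{xs \<in> words S r. prod_list xs = m} \<subseteq> ordered_factorizations m"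
    using assms by (auto simp: words_def ordered_factorizations_def)
  thus ?thesis using assms(3) finite_ordered_factorizations[of m] by (simp add: kalmar_K_def card_mono)
qed

text \<open>
  The second-moment argument. Markov's inequality is applied to one functional \<open>\<Phi>\<close> of mean at most 2, which
  adds the squared deviation of \<open>ln m\<close> and the average over \<open>P\<close> of the relative deviations of the
  exponents of \<open>m\<close>; so \<open>\<Phi> \<le> 4\<close> has probability at least \<open>1/2\<close>. Each product \<open>m\<close> is hit with
  probability at most \<open>K(m) m\<^sup>-\<^sup>\<rho> Z\<^sup>-\<^sup>r\<close>, where \<open>Z\<close> normalizes the weights on \<open>S\<close>, and
  \<open>card_lattice_points_le\<close> bounds the number of products with \<open>\<Phi> \<le> 4\<close>.
\<close>
lemma large_value_in_typical_set:
  fixes S P :: "nat set" and r :: nat and V :: real and s :: "nat \<Rightarrow> real"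
  defines "Z \<equiv> (\<Sum>x\<in>S. real x powr -rho)"
  defines "\<mu> \<equiv> (\<Sum>x\<in>S. real x powr -rho * ln (real x)) / Z"
  assumes S: "finite S" "S \<noteq> {}" "\<And>x. x \<in> S \<Longrightarrow> x \<ge> 2"
    and P: "finite P" "P \<noteq> {}" "\<And>p. p \<in> P \<Longrightarrow> prime p"
    and smooth: "\<And>x. x \<in> S \<Longrightarrow> prime_factors x \<subseteq> P"
    and r: "r \<ge> 1" and V: "V > 0" and s: "\<And>p. p \<in> P \<Longrightarrow> s p > 0"
    and V_ge: "real r * ((\<Sum>x\<in>S. real x powr -rho * (ln (real x))\<^sup>2) / Z) \<le> V"
    and s_ge: "\<And>p. p \<in> P \<Longrightarrow>
        real r * ((\<Sum>x\<in>S. real x powr -rho * (real (multiplicity p x))\<^sup>2) / Z) \<le> (s p)\<^sup>2"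
  shows "\<exists>m>0. \<bar>ln (real m) - real r * \<mu>\<bar> \<le> 2 * sqrt V \<and>
           ln (real (kalmar_K m)) \<ge> rho * ln (real m) + real r * ln Z - ln 2
              - (4 * real (card P) + (\<Sum>p\<in>P. ln (2 * (1 + s p))))"
proof -
  define q where "q = (\<lambda>x::nat. real x powr -rho / Z)"
  define w where "w = (\<lambda>xs. prod_list (map q xs))"
  define W where "W = words S r"
  define e where "e = (\<lambda>p. \<Sum>x\<in>S. q x * real (multiplicity p x))"
  define k where "k = real (card P)"
  have k: "k > 0" using P by (simp add: k_def card_gt_0_iff)
  have x0: "x > 0" if "x \<in> S" for x using S(3)[OF that] by simp
  have Z: "Z > 0" unfolding Z_def using S x0 by (intro sum_pos) auto
  have q: "(\<Sum>x\<in>S. q x) = 1" using Z by (simp add: q_def Z_def flip: sum_divide_distrib)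
  have q0: "q x \<ge> 0" for x using Z by (simp add: q_def)
  have w0: "w xs \<ge> 0" for xs unfolding w_def using q0 by (induction xs) auto
  have finW: "finite W" unfolding W_def by (rule finite_words[OF S(1)])
  have w1: "(\<Sum>xs\<in>W. w xs) = 1" unfolding w_def W_def by (rule sum_words_weight[OF q])
  have Wnz: "0 \<notin> set xs" if "xs \<in> W" for xs using that x0 by (auto simp: W_def words_def)
  define dl where "dl = (\<lambda>xs. ln (real (prod_list xs)) - real r * \<mu>)"
  define dm where "dm = (\<lambda>p xs. real (multiplicity p (prod_list xs)) - real r * e p)"
  have \<mu>: "\<mu> = (\<Sum>x\<in>S. q x * ln (real x))"
    unfolding \<mu>_def q_def by (simp add: sum_divide_distrib)
  have dl2: "(\<Sum>xs\<in>W. w xs * (dl xs)\<^sup>2) \<le> V"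
  proof -
    have "(\<Sum>xs\<in>W. w xs * (dl xs)\<^sup>2)
        = (\<Sum>xs\<in>W. w xs * (sum_list (map (\<lambda>x. ln (real x)) xs) - real r * \<mu>)\<^sup>2)"
      using Wnz by (intro sum.cong) (auto simp: dl_def ln_prod_list)
    also have "\<dots> \<le> real r * (\<Sum>x\<in>S. q x * (ln (real x))\<^sup>2)"
      unfolding w_def W_def by (rule words_variance_le[OF q \<mu>])
    also have "\<dots> \<le> V" using V_ge by (simp add: q_def sum_divide_distrib)
    finally show ?thesis .
  qed
  have dm2: "(\<Sum>xs\<in>W. w xs * (dm p xs)\<^sup>2) \<le> (s p)\<^sup>2" if p: "p \<in> P" for p
  proof -
    have hom: "real (sum_list (map (multiplicity p) xs)) = sum_list (map (\<lambda>x. real (multiplicity p x)) xs)"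
      for xs by (induction xs) auto
    have "(\<Sum>xs\<in>W. w xs * (dm p xs)\<^sup>2)
        = (\<Sum>xs\<in>W. w xs * (sum_list (map (\<lambda>x. real (multiplicity p x)) xs) - real r * e p)\<^sup>2)"
      using Wnz P(3)[OF p] by (intro sum.cong) (auto simp: dm_def multiplicity_prod_list hom)
    also have "\<dots> \<le> real r * (\<Sum>x\<in>S. q x * (real (multiplicity p x))\<^sup>2)"
      unfolding w_def W_def e_def by (rule words_variance_le[OF q refl])
    also have "\<dots> \<le> (s p)\<^sup>2" using s_ge[OF p] by (simp add: q_def sum_divide_distrib)
    finally show ?thesis .
  qed
  have dm1: "(\<Sum>xs\<in>W. w xs * (\<bar>dm p xs\<bar> / s p)) \<le> 1" if p: "p \<in> P" for p
  proof -
    have "(\<Sum>xs\<in>W. w xs * (\<bar>dm p xs\<bar> / s p)) \<le> (\<Sum>xs\<in>W. w xs * ((1 + (dm p xs)\<^sup>2 / (s p)\<^sup>2) / 2))"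
    proof (intro sum_mono mult_left_mono w0)
      fix xs
      have "0 \<le> (\<bar>dm p xs\<bar> / s p - 1)\<^sup>2" by simp
      thus "\<bar>dm p xs\<bar> / s p \<le> (1 + (dm p xs)\<^sup>2 / (s p)\<^sup>2) / 2"
        by (simp add: power2_diff power_divide mult.commute add.commute)
    qed
    also have "\<dots> = ((\<Sum>xs\<in>W. w xs) + (\<Sum>xs\<in>W. w xs * (dm p xs)\<^sup>2) / (s p)\<^sup>2) / 2"
      by (simp add: sum_divide_distrib sum.distrib algebra_simps add_divide_distrib)
    also have "\<dots> \<le> (1 + 1) / 2"
      using dm2[OF p] s[OF p] by (intro divide_right_mono add_mono) (auto simp: w1)
    finally show ?thesis by simp
  qed
  define D where "D = (\<lambda>xs. \<Sum>p\<in>P. \<bar>dm p xs\<bar> / s p)"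
  have D0: "D xs \<ge> 0" for xs unfolding D_def using s
    by (intro sum_nonneg divide_nonneg_pos) auto
  define \<Phi> where "\<Phi> = (\<lambda>xs. (dl xs)\<^sup>2 / V + D xs / k)"
  have \<Phi>0: "\<Phi> xs \<ge> 0" for xs using D0 V k by (simp add: \<Phi>_def)
  have E\<Phi>: "(\<Sum>xs\<in>W. w xs * \<Phi> xs) \<le> 2"
  proof -
    have "(\<Sum>xs\<in>W. w xs * \<Phi> xs) = (\<Sum>xs\<in>W. w xs * (dl xs)\<^sup>2) / V + (\<Sum>xs\<in>W. w xs * D xs) / k"
      by (simp add: \<Phi>_def sum_divide_distrib sum.distrib algebra_simps)
    also have "(\<Sum>xs\<in>W. w xs * (dl xs)\<^sup>2) / V \<le> 1" using dl2 V by (simp add: divide_le_eq)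
    also have "(\<Sum>xs\<in>W. w xs * D xs) / k \<le> 1"
    proof -
      have "(\<Sum>xs\<in>W. w xs * D xs) = (\<Sum>p\<in>P. \<Sum>xs\<in>W. w xs * (\<bar>dm p xs\<bar> / s p))"
        unfolding D_def sum_distrib_left by (rule sum.swap)
      also have "\<dots> \<le> (\<Sum>p\<in>P. 1)" by (intro sum_mono dm1)
      also have "(\<Sum>p\<in>P. 1) = k" by (simp add: k_def)
      finally show ?thesis using k by (simp add: divide_le_eq)
    qed
    finally show ?thesis by simp
  qed
  define F where "F = {xs\<in>W. \<Phi> xs \<le> 4}"
  have finF: "finite F" using finW by (simp add: F_def)
  have F_weight: "(\<Sum>xs\<in>F. w xs) \<ge> 1/2"
  proof -
    have "1 - (\<Sum>xs\<in>F. w xs) = (\<Sum>xs\<in>W - F. w xs)"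
      using sum.subset_diff[of F W w] finW w1 by (simp add: F_def)
    also have "\<dots> \<le> (\<Sum>xs\<in>W - F. w xs * (\<Phi> xs / 4))"
    proof (rule sum_mono)
      fix xs assume "xs \<in> W - F"
      hence "w xs * 1 \<le> w xs * (\<Phi> xs / 4)" using w0 by (intro mult_left_mono) (auto simp: F_def)
      thus "w xs \<le> w xs * (\<Phi> xs / 4)" by simp
    qed
    also have "\<dots> \<le> (\<Sum>xs\<in>W. w xs * (\<Phi> xs / 4))"
      using finW w0 \<Phi>0 by (intro sum_mono2) auto
    also have "\<dots> = (\<Sum>xs\<in>W. w xs * \<Phi> xs) / 4" by (simp add: sum_divide_distrib)
    also have "\<dots> \<le> 1/2" using E\<Phi> by simp
    finally show ?thesis by simp
  qed
  define G where "G = prod_list ` F"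
  have finG: "finite G" using finF by (simp add: G_def)
  have G_ne: "G \<noteq> {}" using F_weight by (auto simp: G_def)
  define R where "R = exp (4 * k) * (\<Prod>p\<in>P. 2 * (1 + s p))"
  have R0: "R > 0" unfolding R_def using s
    by (intro mult_pos_pos prod_pos ballI) (auto intro: add_pos_pos)
  have G_props: "m > 1" "prime_factors m \<subseteq> P" "(\<Sum>p\<in>P. \<bar>real (multiplicity p m) - real r * e p\<bar> / s p) \<le> 4 * k"
     "\<bar>ln (real m) - real r * \<mu>\<bar> \<le> 2 * sqrt V" if "m \<in> G" for m
  proof -
    obtain xs where xs: "xs \<in> W" "\<Phi> xs \<le> 4" "m = prod_list xs" using \<open>m \<in> G\<close> by (auto simp: G_def F_def)
    have len: "length xs = r" "set xs \<subseteq> S" using xs by (auto simp: W_def words_def)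
    have "2 ^ 1 \<le> (2::nat) ^ r" using r by (intro power_increasing) auto
    also have "\<dots> \<le> m" using prod_list_ge_power2[of xs] S(3) xs len by auto
    finally show "m > 1" by simp
    have "prime_factors (prod_list ys) \<subseteq> P" if "set ys \<subseteq> S" for ys
      using that
    proof (induction ys)
      case (Cons y ys)
      have "y \<noteq> 0" "prod_list ys \<noteq> 0" using Cons.prems x0 by (auto simp: prod_list_zero_iff)
      thus ?case using Cons smooth[of y] by (simp add: prime_factors_product)
    qed auto
    thus "prime_factors m \<subseteq> P" using len xs by simp
    have parts: "(dl xs)\<^sup>2 / V \<ge> 0" "D xs / k \<ge> 0" "(dl xs)\<^sup>2 / V + D xs / k \<le> 4"
      using xs(2) V D0[of xs] k by (auto simp: \<Phi>_def)
    have "D xs / k \<le> 4" using parts by linarith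
    thus "(\<Sum>p\<in>P. \<bar>real (multiplicity p m) - real r * e p\<bar> / s p) \<le> 4 * k"
      using k by (simp add: D_def dm_def xs(3) divide_le_eq)
    have "(dl xs)\<^sup>2 / V \<le> 4" using parts by linarith
    hence "(dl xs)\<^sup>2 \<le> 4 * V" using V by (simp add: divide_le_eq)
    hence "sqrt ((dl xs)\<^sup>2) \<le> sqrt (4 * V)" by (rule real_sqrt_le_mono)
    thus "\<bar>ln (real m) - real r * \<mu>\<bar> \<le> 2 * sqrt V"
      by (simp add: real_sqrt_mult dl_def xs(3))
  qed
  have card_G: "real (card G) \<le> R"
    unfolding R_def
  proof (rule card_lattice_points_le[where v = "\<lambda>m p. multiplicity p m" and c = "\<lambda>p. real r * e p"])
    show "m = n" if "m \<in> G" "n \<in> G" "\<And>p. p \<in> P \<Longrightarrow> multiplicity p m = multiplicity p n" for m n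
      using G_props(1,2)[OF that(1)] G_props(1,2)[OF that(2)] P(3) that(3)
      by (intro smooth_eqI[of m n P]) auto
  qed (use P finG s G_props(3) in auto)
  have "\<exists>m\<in>G. real (kalmar_K m) * real m powr -rho / Z ^ r \<ge> 1 / (2 * R)"
  proof (rule ccontr)
    assume "\<not> ?thesis"
    hence less: "real (kalmar_K m) * real m powr -rho / Z ^ r < 1 / (2 * R)" if "m \<in> G" for m
      using that by force
    have "(\<Sum>xs\<in>F. w xs) = (\<Sum>m\<in>G. \<Sum>xs | xs \<in> F \<and> prod_list xs = m. w xs)"
      unfolding G_def by (rule sum.image_gen[OF finF])
    also have "\<dots> \<le> (\<Sum>m\<in>G. real (kalmar_K m) * real m powr -rho / Z ^ r)"
    proof (rule sum_mono)
      fix m assume m: "m \<in> G"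
      have "(\<Sum>xs | xs \<in> F \<and> prod_list xs = m. w xs) \<le> (\<Sum>xs | xs \<in> W \<and> prod_list xs = m. w xs)"
        using finW w0 by (intro sum_mono2) (auto simp: F_def)
      also have "\<dots> = (\<Sum>xs | xs \<in> W \<and> prod_list xs = m. real m powr -rho / Z ^ r)"
      proof (intro sum.cong refl)
        fix xs assume xs: "xs \<in> {xs. xs \<in> W \<and> prod_list xs = m}"
        hence "length xs = r" "0 \<notin> set xs" using Wnz by (auto simp: W_def words_def)
        thus "w xs = real m powr -rho / Z ^ r"
          using xs unfolding w_def q_def by (subst weight_powr) auto
      qed
      also have "\<dots> = real (card {xs\<in>W. prod_list xs = m}) * (real m powr -rho / Z ^ r)" by simp
      also have "\<dots> \<le> real (kalmar_K m) * (real m powr -rho / Z ^ r)"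
        unfolding W_def using r S(3) G_props(1)[OF m] Z
        by (intro mult_right_mono of_nat_mono card_words_le_kalmar_K) auto
      finally show "(\<Sum>xs | xs \<in> F \<and> prod_list xs = m. w xs) \<le> real (kalmar_K m) * real m powr -rho / Z ^ r"
        by simp
    qed
    also have "\<dots> < (\<Sum>m\<in>G. 1 / (2 * R))"
      using less finG G_ne by (intro sum_strict_mono) auto
    also have "\<dots> \<le> 1/2" using card_G R0 by (simp add: field_simps)
    finally show False using F_weight by simp
  qed
  then obtain m where m: "m \<in> G" "1 / (2 * R) \<le> real (kalmar_K m) * real m powr -rho / Z ^ r" by blast
  have m0: "m > 0" using G_props(1)[OF m(1)] by simp
  have "ln (1 / (2 * R)) \<le> ln (real (kalmar_K m) * real m powr -rho / Z ^ r)"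
    using m(2) R0 by (subst ln_le_cancel_iff) (auto intro: less_le_trans[OF _ m(2)])
  also have "\<dots> = ln (real (kalmar_K m)) - rho * ln (real m) - real r * ln Z"
    using m0 kalmar_K_pos[OF m0] Z by (simp add: ln_div ln_mult ln_powr ln_realpow)
  also have "ln (1 / (2 * R)) = - ln 2 - ln R" using R0 by (simp add: ln_div ln_mult)
  also have "ln R = 4 * k + (\<Sum>p\<in>P. ln (2 * (1 + s p)))"
  proof -
    have pos: "2 * (1 + s p) > 0" if "p \<in> P" for p using s[OF that] by simp
    have "(\<Prod>p\<in>P. 2 * (1 + s p)) > 0" by (intro prod_pos ballI pos)
    hence "ln R = 4 * k + ln (\<Prod>p\<in>P. 2 * (1 + s p))" unfolding R_def by (subst ln_mult_pos) simp_all
    also have "ln (\<Prod>p\<in>P. 2 * (1 + s p)) = (\<Sum>p\<in>P. ln (2 * (1 + s p)))"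
      by (rule ln_prod[OF P(1)]) (use pos in force)
    finally show ?thesis .
  qed
  finally have "ln (real (kalmar_K m)) \<ge> rho * ln (real m) + real r * ln Z - ln 2
              - (4 * real (card P) + (\<Sum>p\<in>P. ln (2 * (1 + s p))))"
    unfolding k_def by linarith
  thus ?thesis using G_props(4)[OF m(1)] m0 by blast
qed

section \<open>Moments and the smooth part of zeta\<close>

lemma ln_square_moment_bound:
  "\<exists>C>0. \<forall>X. (\<Sum>n\<in>{0<..X}. real n powr -rho * (ln (real n))\<^sup>2) \<le> C"
proof -
  define \<epsilon> where "\<epsilon> = (rho - 1) / 4"
  have e: "\<epsilon> > 0" "rho - 2 * \<epsilon> > 1" using rho_props by (auto simp: \<epsilon>_def field_simps)
  have zpos: "real_zeta (rho - 2 * \<epsilon>) \<ge> 1" using sum_powr_le_zeta[OF e(2), of "{1}"] by simp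
  show ?thesis
  proof (intro exI[of _ "real_zeta (rho - 2 * \<epsilon>) / \<epsilon>\<^sup>2"] conjI allI)
    show "real_zeta (rho - 2 * \<epsilon>) / \<epsilon>\<^sup>2 > 0" using zpos e by simp
    fix X
    have "(\<Sum>n\<in>{0<..X}. real n powr -rho * (ln (real n))\<^sup>2)
        \<le> (\<Sum>n\<in>{0<..X}. real n powr -(rho - 2 * \<epsilon>) / \<epsilon>\<^sup>2)"
    proof (rule sum_mono)
      fix n assume n: "n \<in> {0<..X}"
      have "ln (real n) \<le> real n powr \<epsilon> / \<epsilon>" using n e by (intro ln_powr_bound) auto
      hence "(ln (real n))\<^sup>2 \<le> (real n powr \<epsilon> / \<epsilon>)\<^sup>2" using n by (intro power_mono) auto
      also have "\<dots> = real n powr (2 * \<epsilon>) / \<epsilon>\<^sup>2"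
        by (simp add: power_divide power2_eq_square flip: powr_add)
      finally have "real n powr -rho * (ln (real n))\<^sup>2 \<le> real n powr -rho * (real n powr (2 * \<epsilon>) / \<epsilon>\<^sup>2)"
        by (intro mult_left_mono) auto
      thus "real n powr -rho * (ln (real n))\<^sup>2 \<le> real n powr -(rho - 2 * \<epsilon>) / \<epsilon>\<^sup>2"
        by (simp flip: powr_add)
    qed
    also have "\<dots> = (\<Sum>n\<in>{0<..X}. real n powr -(rho - 2 * \<epsilon>)) / \<epsilon>\<^sup>2"
      by (simp add: sum_divide_distrib)
    also have "\<dots> \<le> real_zeta (rho - 2 * \<epsilon>) / \<epsilon>\<^sup>2"
      using e by (intro divide_right_mono sum_powr_le_zeta) auto
    finally show "(\<Sum>n\<in>{0<..X}. real n powr -rho * (ln (real n))\<^sup>2) \<le> real_zeta (rho - 2 * \<epsilon>) / \<epsilon>\<^sup>2" .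
  qed
qed

text \<open>
  Writing \<open>n = p m\<close> gives \<open>U \<le> p\<^sup>-\<^sup>\<rho> (2 U + 4)\<close> for the sum \<open>U\<close> itself, and \<open>2 p\<^sup>-\<^sup>\<rho> < 1\<close> because
  \<open>\<rho> > 1\<close>.
\<close>
lemma multiplicity_square_moment_bound:
  "\<exists>C\<ge>1. \<forall>p X. prime p \<longrightarrow>
     (\<Sum>n\<in>{0<..X}. real n powr -rho * (real (multiplicity p n))\<^sup>2) \<le> C * real p powr -rho"
proof -
  define \<theta> where "\<theta> = 1 - 2 * 2 powr -rho"
  have "2 powr -rho < 2 powr (-1::real)" using rho_props by (intro powr_less_mono) auto
  hence \<theta>: "0 < \<theta>" "\<theta> \<le> 1" by (auto simp: \<theta>_def powr_minus)
  show ?thesis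
  proof (intro exI[of _ "4 / \<theta>"] conjI allI impI)
    show "4 / \<theta> \<ge> 1" using \<theta> by simp
    fix p X :: nat assume p: "prime p"
    have p0: "p > 0" "p \<ge> 2" using p prime_ge_2_nat prime_gt_0_nat by auto
    let ?v = "\<lambda>n. real (multiplicity p n)"
    define U where "U = (\<Sum>n\<in>{0<..X}. real n powr -rho * (?v n)\<^sup>2)"
    have U0: "U \<ge> 0" unfolding U_def by (intro sum_nonneg) auto
    have "U = (\<Sum>n | n \<in> {0<..X} \<and> p dvd n. real n powr -rho * (?v n)\<^sup>2)"
      unfolding U_def
    proof (rule sum.mono_neutral_right)
      show "\<forall>n\<in>{0<..X} - {n \<in> {0<..X}. p dvd n}. real n powr -rho * (?v n)\<^sup>2 = 0"
      proof
        fix n assume "n \<in> {0<..X} - {n \<in> {0<..X}. p dvd n}"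
        hence "multiplicity p n = 0" by (intro not_dvd_imp_multiplicity_0) auto
        thus "real n powr -rho * (?v n)\<^sup>2 = 0" by simp
      qed
    qed auto
    also have "\<dots> \<le> (\<Sum>m\<in>{0<..X}. real (p * m) powr -rho * (?v (p * m))\<^sup>2)"
      using p0 by (intro sum_multiples_le) auto
    also have "\<dots> \<le> (\<Sum>m\<in>{0<..X}. real p powr -rho * (2 * (real m powr -rho * (?v m)\<^sup>2) + 2 * real m powr -rho))"
    proof (rule sum_mono)
      fix m assume m: "m \<in> {0<..X}"
      have "multiplicity p (p * m) = Suc (multiplicity p m)"
        using p m by (intro multiplicity_times_same) auto
      hence "(?v (p * m))\<^sup>2 \<le> 2 * (?v m)\<^sup>2 + 2"
        using zero_le_power2[of "?v m - 1"] by (simp add: power2_eq_square algebra_simps)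
      hence "real (p * m) powr -rho * (?v (p * m))\<^sup>2 \<le> real (p * m) powr -rho * (2 * (?v m)\<^sup>2 + 2)"
        by (intro mult_left_mono) auto
      thus "real (p * m) powr -rho * (?v (p * m))\<^sup>2
          \<le> real p powr -rho * (2 * (real m powr -rho * (?v m)\<^sup>2) + 2 * real m powr -rho)"
        by (simp add: powr_mult algebra_simps)
    qed
    also have "\<dots> = real p powr -rho * (2 * U + 2 * (\<Sum>m\<in>{0<..X}. real m powr -rho))"
      by (simp add: U_def sum_distrib_left sum.distrib distrib_left)
    also have "\<dots> \<le> real p powr -rho * (2 * U + 2 * 2)"
      using sum_powr_rho_le_2[of X] by (intro mult_left_mono) auto
    finally have 1: "U \<le> real p powr -rho * (2 * U) + real p powr -rho * 4"
      by (simp add: distrib_left)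
    have "real p powr -rho \<le> 2 powr -rho" using p0 rho_props by (intro powr_mono2') auto
    hence "real p powr -rho * (2 * U) \<le> 2 powr -rho * (2 * U)" using U0 by (intro mult_right_mono) auto
    with 1 have "\<theta> * U \<le> real p powr -rho * 4" by (simp add: \<theta>_def algebra_simps)
    thus "(\<Sum>n\<in>{0<..X}. real n powr -rho * (?v n)\<^sup>2) \<le> 4 / \<theta> * real p powr -rho"
      using \<theta> by (simp add: U_def field_simps)
  qed
qed

text \<open>
  What is discarded is either divisible by a prime above \<open>y\<close>, with mass at most twice the sum of \<open>p\<^sup>-\<^sup>\<rho>\<close> over
  these primes, or larger than \<open>y\<^sup>2\<close>. The cut-off \<open>y\<^sup>2\<close> keeps the set of letters finite; its tail
  \<open>y powr (2 (1-\<rho>))\<close> is smaller than the allowed error.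
\<close>
lemma smooth_zeta_deficit:
  "\<exists>C>0. \<forall>y\<ge>2. 1 - (\<Sum>x | x \<in> {2..y\<^sup>2} \<and> (\<forall>p\<in>prime_factors x. p \<le> y). real x powr -rho)
      \<le> C * (real y powr (1-rho) / ln (real y))"
proof -
  have r1: "rho - 1 > 0" using rho_props by simp
  obtain C where C: "C > 0" "\<And>y P. y \<ge> 2 \<Longrightarrow> finite P \<Longrightarrow> (\<forall>p\<in>P. prime p \<and> y < p) \<Longrightarrow>
           (\<Sum>p\<in>P. real p powr -rho) \<le> C * (real y powr (1-rho) / ln (real y))"
    using prime_powr_tail[of rho] rho_props by metis
  show ?thesis
  proof (intro exI[of _ "2 * C + 1 / (rho - 1)\<^sup>2"] conjI allI impI)
    show "2 * C + 1 / (rho - 1)\<^sup>2 > 0" using C r1 by (intro add_pos_pos) auto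
    fix y :: nat assume y: "y \<ge> 2"
    have lny: "ln (real y) > 0" using y by simp
    define X where "X = y\<^sup>2"
    have X: "X \<ge> 1" using y by (simp add: X_def)
    define S where "S = {x. x \<in> {2..X} \<and> (\<forall>p\<in>prime_factors x. p \<le> y)}"
    define P where "P = {p. prime p \<and> y < p \<and> p \<le> X}"
    have finP: "finite P" by (simp add: P_def)
    have "(\<Sum>x\<in>{2..X}. real x powr -rho) = (\<Sum>x\<in>{2..X} - S. real x powr -rho) + (\<Sum>x\<in>S. real x powr -rho)"
      by (intro sum.subset_diff) (auto simp: S_def)
    moreover have "(\<Sum>x\<in>{2..X} - S. real x powr -rho) \<le> 2 * (\<Sum>p\<in>P. real p powr -rho)"
    proof -
      have "(\<Sum>x\<in>{2..X} - S. real x powr -rho)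
          \<le> (\<Sum>x\<in>{2..X} - S. \<Sum>p\<in>P. if p dvd x then real x powr -rho else 0)"
      proof (rule sum_mono)
        fix x assume x: "x \<in> {2..X} - S"
        then obtain p where p: "p \<in> prime_factors x" "p > y" by (auto simp: S_def not_le)
        hence "p \<le> x" using x by (auto intro!: dvd_imp_le)
        hence pP: "p \<in> P" using p x by (auto simp: P_def)
        have "real x powr -rho = (\<Sum>p\<in>{p}. if p dvd x then real x powr -rho else 0)"
          using p by auto
        also have "\<dots> \<le> (\<Sum>p\<in>P. if p dvd x then real x powr -rho else 0)"
          using pP finP by (intro sum_mono2) auto
        finally show "real x powr -rho \<le> (\<Sum>p\<in>P. if p dvd x then real x powr -rho else 0)" .
      qed
      also have "\<dots> = (\<Sum>p\<in>P. \<Sum>x\<in>{2..X} - S. if p dvd x then real x powr -rho else 0)"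
        by (rule sum.swap)
      also have "\<dots> \<le> (\<Sum>p\<in>P. 2 * real p powr -rho)"
      proof (rule sum_mono)
        fix p assume p: "p \<in> P"
        hence p0: "p > 0" by (simp add: P_def)
        have "(\<Sum>x\<in>{2..X} - S. if p dvd x then real x powr -rho else 0)
            = (\<Sum>x | x \<in> {2..X} - S \<and> p dvd x. real x powr -rho)"
          by (intro sum.mono_neutral_cong_right) auto
        also have "\<dots> \<le> (\<Sum>x | x \<in> {0<..X} \<and> p dvd x. real x powr -rho)"
          by (intro sum_mono2) auto
        also have "\<dots> \<le> (\<Sum>m\<in>{0<..X}. real (p * m) powr -rho)"
          using p0 by (intro sum_multiples_le) auto
        also have "\<dots> = real p powr -rho * (\<Sum>m\<in>{0<..X}. real m powr -rho)"
          by (simp add: powr_mult sum_distrib_left)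
        also have "\<dots> \<le> real p powr -rho * 2"
          by (intro mult_left_mono sum_powr_rho_le_2) auto
        finally show "(\<Sum>x\<in>{2..X} - S. if p dvd x then real x powr -rho else 0) \<le> 2 * real p powr -rho"
          by simp
      qed
      finally show ?thesis by (simp add: sum_distrib_left)
    qed
    moreover have "(\<Sum>p\<in>P. real p powr -rho) \<le> C * (real y powr (1-rho) / ln (real y))"
      using y finP by (intro C) (auto simp: P_def)
    moreover have "1 - real X powr (1-rho) / (rho-1) \<le> (\<Sum>x\<in>{2..X}. real x powr -rho)"
      by (rule sum_powr_rho_ge[OF X])
    moreover have "real X powr (1-rho) / (rho-1) \<le> 1 / (rho - 1)\<^sup>2 * (real y powr (1-rho) / ln (real y))"
    proof -
      have "ln (real y) \<le> real y powr (rho - 1) / (rho - 1)"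
        using y r1 by (intro ln_powr_bound) auto
      hence "(rho - 1) * ln (real y) \<le> real y powr (rho - 1)" using r1 by (simp add: field_simps)
      hence "1 / real y powr (rho - 1) \<le> 1 / ((rho - 1) * ln (real y))"
        using r1 lny y by (intro divide_left_mono) auto
      moreover have "1 / real y powr (rho - 1) = real y powr (1 - rho)"
        using powr_minus_divide[of "real y" "rho - 1"] by simp
      ultimately have "real y powr (1 - rho) \<le> 1 / ((rho - 1) * ln (real y))" by simp
      hence "real y powr (1 - rho) * real y powr (1 - rho) \<le> real y powr (1 - rho) * (1 / ((rho - 1) * ln (real y)))"
        by (intro mult_left_mono) auto
      moreover have "real X powr (1 - rho) = real y powr (1 - rho) * real y powr (1 - rho)"
        using y by (simp add: X_def power2_eq_square powr_mult)
      ultimately have "real X powr (1-rho) / (rho-1) \<le> real y powr (1 - rho) * (1 / ((rho - 1) * ln (real y))) / (rho - 1)"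
        using r1 by (intro divide_right_mono) auto
      thus ?thesis by (simp add: power2_eq_square mult_ac)
    qed
    ultimately have "1 - (\<Sum>x\<in>S. real x powr -rho) \<le> 2 * (C * (real y powr (1-rho) / ln (real y)))
        + 1 / (rho - 1)\<^sup>2 * (real y powr (1-rho) / ln (real y))" by linarith
    thus "1 - (\<Sum>x | x \<in> {2..y\<^sup>2} \<and> (\<forall>p\<in>prime_factors x. p \<le> y). real x powr -rho)
      \<le> (2 * C + 1 / (rho - 1)\<^sup>2) * (real y powr (1-rho) / ln (real y))"
      unfolding S_def X_def by (simp only: distrib_right mult.assoc)
  qed
qed

section \<open>Large values of K\<close>

lemma floor_bounds:
  fixes Y :: real
  assumes "Y \<ge> 4"
  shows "nat \<lfloor>Y\<rfloor> \<ge> 2" "real (nat \<lfloor>Y\<rfloor>) \<le> Y" "Y / 2 \<le> real (nat \<lfloor>Y\<rfloor>)"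
proof -
  show "nat \<lfloor>Y\<rfloor> \<ge> 2" "real (nat \<lfloor>Y\<rfloor>) \<le> Y"
    using assms by (auto simp: le_nat_iff le_floor_iff)
  have "Y < real (nat \<lfloor>Y\<rfloor>) + 1" using assms by linarith
  thus "Y / 2 \<le> real (nat \<lfloor>Y\<rfloor>)" using assms by linarith
qed

lemma floor_powr_div_ln_le:
  fixes Y :: real
  assumes Y: "Y \<ge> 4"
  shows "real (nat \<lfloor>Y\<rfloor>) powr (1-rho) / ln (real (nat \<lfloor>Y\<rfloor>)) \<le> 4 * (Y powr (1-rho) / ln Y)"
proof -
  define y where "y = nat \<lfloor>Y\<rfloor>"
  have y: "y \<ge> 2" "real y \<le> Y" "Y / 2 \<le> real y"
    unfolding y_def using floor_bounds[OF Y] by auto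
  have "real y powr (1-rho) / ln (real y) \<le> (2 * Y powr (1 - rho)) / (ln Y / 2)"
  proof (rule frac_le)
    have "real y powr (1-rho) \<le> (Y / 2) powr (1 - rho)"
      using y Y rho_props by (intro powr_mono2') auto
    also have "\<dots> = Y powr (1 - rho) * 2 powr (rho - 1)"
    proof -
      have "(2::real) powr (1 - rho) = 1 / 2 powr (rho - 1)"
        using powr_minus_divide[of "2::real" "rho - 1"] by simp
      thus ?thesis using Y by (simp add: powr_divide)
    qed
    also have "\<dots> \<le> Y powr (1 - rho) * 2 powr 1"
      using rho_props by (intro mult_left_mono powr_mono) auto
    finally show "real y powr (1-rho) \<le> 2 * Y powr (1 - rho)" by simp
    have "sqrt Y \<le> Y / 2"
    proof -
      have "sqrt Y \<ge> sqrt 4" using Y by (intro real_sqrt_le_mono)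
      hence "sqrt Y * 2 \<le> sqrt Y * sqrt Y" using Y by (intro mult_left_mono) auto
      thus ?thesis using Y by simp
    qed
    hence "ln (sqrt Y) \<le> ln (real y)" using y Y by (subst ln_le_cancel_iff) auto
    thus "ln Y / 2 \<le> ln (real y)" using Y by (simp add: ln_sqrt)
  qed (use Y in auto)
  thus ?thesis by (simp add: y_def)
qed

text \<open>
  Assembling the error terms, with \<open>Y = L powr (1/\<rho>)\<close>: the number of letters is at most \<open>2 L\<close>, so the
  normalizing factor \<open>Z\<^sup>r\<close> costs \<open>O(L Y powr (1-\<rho>) / ln Y) = O(Y / ln Y)\<close>; the number of typical
  products costs the same by \<open>prime_ln_quotient_sum\<close>; and aiming two standard deviations below \<open>L\<close>, to be
  sure that \<open>ln m \<le> L\<close>, costs \<open>O(\<surd>L)\<close>.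
\<close>
lemma large_values:
  "\<exists>C>0. \<forall>\<^sub>F L in at_top. \<exists>m>0. ln (real m) \<le> L \<and>
     ln (real (kalmar_K m)) \<ge> rho * L - C * (L powr (1 / rho) / ln L)"
proof -
  obtain C1 where C1: "C1 > 0" "\<And>X. (\<Sum>n\<in>{0<..X}. real n powr -rho * (ln (real n))\<^sup>2) \<le> C1"
    using ln_square_moment_bound by blast
  obtain C2 where C2: "C2 \<ge> 1" "\<And>p X. prime p \<Longrightarrow>
     (\<Sum>n\<in>{0<..X}. real n powr -rho * (real (multiplicity p n))\<^sup>2) \<le> C2 * real p powr -rho"
    using multiplicity_square_moment_bound by blast
  obtain C3 where C3: "C3 > 0" "\<And>Y. Y \<ge> 2 \<Longrightarrow>
      (\<Sum>p | prime p \<and> p \<le> nat \<lfloor>Y\<rfloor>. 1 + ln (Y / real p)) \<le> C3 * (Y / ln Y)"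
    using prime_ln_quotient_sum by blast
  obtain C5 where C5: "C5 > 0" "\<And>y. y \<ge> 2 \<Longrightarrow>
      1 - (\<Sum>x | x \<in> {2..y\<^sup>2} \<and> (\<forall>p\<in>prime_factors x. p \<le> y). real x powr -rho)
      \<le> C5 * (real y powr (1-rho) / ln (real y))"
    using smooth_zeta_deficit by blast
  define \<alpha> where "\<alpha> = 1 / rho"
  have \<alpha>: "1 / 2 < \<alpha>" "\<alpha> < 1" using rho_props by (auto simp: \<alpha>_def field_simps)
  define b where "b = 8 * C1"
  define c4 where "c4 = 4 * C1 / ln 2"
  define a where "a = sqrt (8 * C2)"
  have b: "b > 0" and c4: "c4 > 0" using C1 by (auto simp: b_def c4_def)
  have a1: "a \<ge> 1" using C2 by (simp add: a_def)
  define C where "C = 1 + 32 * C5 * rho + (5 + ln (4 * a)) * C3 * rho"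
  have lna: "ln (4 * a) \<ge> 0" using a1 by simp
  have "C > 0" unfolding C_def using C5 C3 rho_props lna by (intro add_pos_pos mult_pos_pos add_pos_nonneg) auto
  have ev1: "\<forall>\<^sub>F L in at_top. L \<ge> (2::real)" by (rule eventually_ge_at_top)
  have ev2: "\<forall>\<^sub>F L in at_top. L powr \<alpha> \<ge> 4" using \<alpha> by real_asymp
  have ev3: "\<forall>\<^sub>F L in at_top. L - 2 * sqrt (b * L) \<ge> c4" using b by real_asymp
  have ev4: "\<forall>\<^sub>F L in at_top. rho * (4 * sqrt (b * L) + c4) + ln 2 \<le> L powr \<alpha> / ln L"
    using \<alpha> b by real_asymp
  have "\<forall>\<^sub>F L in at_top. \<exists>m>0. ln (real m) \<le> L \<and>
     ln (real (kalmar_K m)) \<ge> rho * L - C * (L powr (1 / rho) / ln L)"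
    using ev1 ev2 ev3 ev4
  proof eventually_elim
    case (elim L)
    define Y where "Y = L powr \<alpha>"
    define y where "y = nat \<lfloor>Y\<rfloor>"
    have Y: "Y \<ge> 4" using elim by (simp add: Y_def)
    have y: "y \<ge> 2" "real y \<le> Y" "Y / 2 \<le> real y"
      unfolding y_def using floor_bounds[OF Y] by auto
    have L0: "L > 0" "ln L > 0" using elim by auto
    have lnY: "ln Y = ln L / rho" using L0 by (simp add: Y_def \<alpha>_def ln_powr)
    have lnY0: "ln Y > 0" using Y by simp
    have YL: "Y powr rho = L" using L0 rho_props by (simp add: Y_def \<alpha>_def powr_powr)
    define P where "P = {p. prime p \<and> p \<le> y}"
    define S where "S = {x. x \<in> {2..y\<^sup>2} \<and> (\<forall>p\<in>prime_factors x. p \<le> y)}"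
    define Z where "Z = (\<Sum>x\<in>S. real x powr -rho)"
    define \<mu> where "\<mu> = (\<Sum>x\<in>S. real x powr -rho * ln (real x)) / Z"
    have finS: "finite S" by (simp add: S_def)
    have subS: "S \<subseteq> {0<..y\<^sup>2}" by (auto simp: S_def)
    have finP: "finite P" by (simp add: P_def)
    have "2 * 1 \<le> y * y" using y by (intro mult_le_mono) auto
    hence "2 \<in> S" using y by (auto simp: S_def power2_eq_square prime_prime_factors)
    have "2 \<in> P" using y by (simp add: P_def)
    have "1/4 \<le> Z"
    proof -
      have "1/4 = 2 powr (-2::real)" by (simp add: powr_minus)
      also have "\<dots> \<le> 2 powr -rho" using rho_props by (intro powr_mono) auto
      also have "\<dots> = (\<Sum>x\<in>{2}. real x powr -rho)" by simp
      also have "\<dots> \<le> Z" unfolding Z_def using finS \<open>2 \<in> S\<close> by (intro sum_mono2) auto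
      finally show ?thesis .
    qed
    hence Z0: "Z > 0" by simp
    have M1: "(\<Sum>x\<in>S. real x powr -rho * (ln (real x))\<^sup>2) / Z \<le> 4 * C1"
    proof -
      have "(\<Sum>x\<in>S. real x powr -rho * (ln (real x))\<^sup>2) \<le> C1"
        using subS by (intro order_trans[OF sum_mono2 C1(2)]) auto
      also have "C1 \<le> 4 * C1 * Z" using \<open>1/4 \<le> Z\<close> C1 by simp
      finally show ?thesis using Z0 by (simp add: divide_le_eq)
    qed
    have M2: "(\<Sum>x\<in>S. real x powr -rho * (real (multiplicity p x))\<^sup>2) / Z \<le> 4 * C2 * real p powr -rho"
      if p: "p \<in> P" for p
    proof -
      have "(\<Sum>x\<in>S. real x powr -rho * (real (multiplicity p x))\<^sup>2) \<le> C2 * real p powr -rho"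
        using subS p by (intro order_trans[OF sum_mono2 C2(2)]) (auto simp: P_def)
      also have "\<dots> \<le> C2 * real p powr -rho * (4 * Z)"
        using mult_left_mono[of 1 "4 * Z" "C2 * real p powr -rho"] \<open>1/4 \<le> Z\<close> C2(1) by simp
      finally show ?thesis using Z0 by (simp add: divide_le_eq mult_ac)
    qed
    have \<mu>_ge: "\<mu> \<ge> ln 2"
    proof -
      have "ln 2 * Z = (\<Sum>x\<in>S. real x powr -rho * ln 2)"
        by (simp add: Z_def sum_distrib_left mult.commute)
      also have "\<dots> \<le> (\<Sum>x\<in>S. real x powr -rho * ln (real x))"
        by (intro sum_mono mult_left_mono) (auto simp: S_def)
      finally show ?thesis using Z0 by (simp add: \<mu>_def le_divide_eq)
    qed
    have \<mu>_le: "\<mu> \<le> c4"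
    proof -
      have "(\<Sum>x\<in>S. real x powr -rho * ln (real x))
          \<le> (\<Sum>x\<in>S. real x powr -rho * (ln (real x))\<^sup>2 / ln 2)"
      proof (rule sum_mono)
        fix x assume "x \<in> S"
        hence "ln 2 \<le> ln (real x)" by (auto simp: S_def)
        hence "ln (real x) * ln 2 \<le> ln (real x) * ln (real x)"
          by (intro mult_left_mono) (auto intro: order_trans[of _ "ln 2"])
        hence "ln (real x) \<le> (ln (real x))\<^sup>2 / ln 2" by (simp add: power2_eq_square le_divide_eq)
        hence "real x powr -rho * ln (real x) \<le> real x powr -rho * ((ln (real x))\<^sup>2 / ln 2)"
          by (intro mult_left_mono) auto
        thus "real x powr -rho * ln (real x) \<le> real x powr -rho * (ln (real x))\<^sup>2 / ln 2" by simp
      qed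
      hence "\<mu> \<le> (\<Sum>x\<in>S. real x powr -rho * (ln (real x))\<^sup>2) / ln 2 / Z"
        unfolding \<mu>_def using Z0 by (intro divide_right_mono) (auto simp: sum_divide_distrib)
      also have "\<dots> = (\<Sum>x\<in>S. real x powr -rho * (ln (real x))\<^sup>2) / Z / ln 2" by simp
      also have "\<dots> \<le> 4 * C1 / ln 2" using M1 by (intro divide_right_mono) auto
      finally show ?thesis by (simp add: c4_def)
    qed
    have ln2: "ln (2::real) \<ge> 1/2" using ln_le_minus_one[of "1/2"] by (simp add: ln_div)
    have \<mu>0: "\<mu> > 0" using \<mu>_ge ln2 by linarith
    define V where "V = b * L"
    have V0: "V > 0" using b L0 by (simp add: V_def)
    \<comment> \<open>the largest length for which products of typical words stay below \<open>exp L\<close>\<close>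
    define r where "r = nat \<lfloor>(L - 2 * sqrt V) / \<mu>\<rfloor>"
    have big: "L - 2 * sqrt V \<ge> \<mu>" using elim \<mu>_le by (simp add: V_def)
    hence "(L - 2 * sqrt V) / \<mu> \<ge> 1" using \<mu>0 by (simp add: le_divide_eq)
    hence r: "r \<ge> 1" "real r \<le> (L - 2 * sqrt V) / \<mu>" "(L - 2 * sqrt V) / \<mu> \<le> real r + 1"
      unfolding r_def by (auto simp: le_nat_iff le_floor_iff; linarith)+
    have r1: "real r * \<mu> \<le> L - 2 * sqrt V" "L - 2 * sqrt V - \<mu> \<le> real r * \<mu>"
      using r(2,3) \<mu>0 by (simp_all add: field_simps)
    have r2: "real r \<le> 2 * L"
    proof -
      have "real r * (1/2) \<le> real r * \<mu>" using \<mu>_ge ln2 by (intro mult_left_mono) auto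
      also have "\<dots> \<le> L" using r1 V0 using real_sqrt_gt_zero[OF V0] by linarith
      finally show ?thesis by simp
    qed
    \<comment> \<open>an upper bound for the standard deviation of the exponent of \<open>p\<close>; it is at least 1 as \<open>p \<le> Y\<close>\<close>
    define s where "s = (\<lambda>p::nat. a * (Y / real p) powr (rho / 2))"
    have s_sq: "(s p)\<^sup>2 = 8 * C2 * L * real p powr -rho" if "p \<in> P" for p
    proof -
      have p0: "p > 0" using that prime_gt_0_nat by (auto simp: P_def)
      have "(s p)\<^sup>2 = a\<^sup>2 * ((Y / real p) powr (rho/2) * (Y / real p) powr (rho/2))"
        by (simp add: s_def power2_eq_square)
      also have "\<dots> = 8 * C2 * (Y / real p) powr rho"
        using C2 by (simp add: a_def flip: powr_add)
      also have "(Y / real p) powr rho = L * real p powr -rho"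
        using Y p0 YL by (simp add: powr_divide powr_minus_divide)
      finally show ?thesis by simp
    qed
    have s_ge1: "s p \<ge> 1" if "p \<in> P" for p
    proof -
      have p0: "p > 0" "real p \<le> Y" using that prime_gt_0_nat y by (auto simp: P_def)
      have "(Y / real p) powr (rho / 2) \<ge> 1" using p0 rho_props by (intro ge_one_powr_ge_zero) auto
      thus ?thesis using a1 mult_mono[of 1 a 1 "(Y / real p) powr (rho / 2)"] by (simp add: s_def)
    qed
    have "\<exists>m>0. \<bar>ln (real m) - real r * \<mu>\<bar> \<le> 2 * sqrt V \<and>
           ln (real (kalmar_K m)) \<ge> rho * ln (real m) + real r * ln Z - ln 2
              - (4 * real (card P) + (\<Sum>p\<in>P. ln (2 * (1 + s p))))"
      unfolding \<mu>_def Z_def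
    proof (rule large_value_in_typical_set[OF finS])
      show "S \<noteq> {}" "P \<noteq> {}" using \<open>2 \<in> S\<close> \<open>2 \<in> P\<close> by auto
      show "x \<ge> 2" "prime_factors x \<subseteq> P" if "x \<in> S" for x using that by (auto simp: S_def P_def)
      show "prime p" if "p \<in> P" for p using that by (simp add: P_def)
      show "s p > 0" if "p \<in> P" for p using s_ge1[OF that] by simp
      have "real r * ((\<Sum>x\<in>S. real x powr -rho * (ln (real x))\<^sup>2) / Z) \<le> (2 * L) * (4 * C1)"
        using r2 M1 L0 Z0 by (intro mult_mono) (auto intro!: divide_nonneg_pos sum_nonneg)
      thus "real r * ((\<Sum>x\<in>S. real x powr -rho * (ln (real x))\<^sup>2) / (\<Sum>x\<in>S. real x powr -rho)) \<le> V"
        by (simp add: V_def b_def Z_def mult_ac)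
      show "real r * ((\<Sum>x\<in>S. real x powr -rho * (real (multiplicity p x))\<^sup>2) / (\<Sum>x\<in>S. real x powr -rho)) \<le> (s p)\<^sup>2"
        if p: "p \<in> P" for p
      proof -
        have "real r * ((\<Sum>x\<in>S. real x powr -rho * (real (multiplicity p x))\<^sup>2) / Z) \<le> (2 * L) * (4 * C2 * real p powr -rho)"
          using r2 M2[OF p] L0 Z0 by (intro mult_mono) (auto intro!: divide_nonneg_pos sum_nonneg)
        thus ?thesis by (simp add: s_sq[OF p] Z_def mult_ac)
      qed
    qed (use finP r V0 in auto)
    then obtain m where m: "m > 0" "\<bar>ln (real m) - real r * \<mu>\<bar> \<le> 2 * sqrt V"
      "ln (real (kalmar_K m)) \<ge> rho * ln (real m) + real r * ln Z - ln 2
              - (4 * real (card P) + (\<Sum>p\<in>P. ln (2 * (1 + s p))))"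
      by blast
    have up: "ln (real m) \<le> L" using m(2) r1 by linarith
    have "ln (real m) \<ge> L - (4 * sqrt V + c4)" using m(2) r1 \<mu>_le by linarith
    hence "rho * (L - (4 * sqrt V + c4)) \<le> rho * ln (real m)"
      using rho_props by (intro mult_left_mono) auto
    hence lo: "rho * ln (real m) \<ge> rho * L - rho * (4 * sqrt V + c4)"
      by (simp add: algebra_simps)
    have Zlo: "real r * ln Z \<ge> - (32 * C5 * (Y / ln Y))"
    proof -
      have "ln (1 / Z) \<le> 1 / Z - 1" using Z0 by (intro ln_le_minus_one) auto
      hence "- ln Z \<le> (1 - Z) / Z" using Z0 by (simp add: ln_div diff_divide_distrib)
      also have "\<dots> \<le> (1 - Z) / (1/4)"
      proof -
        have "Z \<le> 1" unfolding Z_def using finS by (intro sum_powr_rho_le_1) (auto simp: S_def)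
        thus ?thesis using \<open>1/4 \<le> Z\<close> by (intro divide_left_mono) auto
      qed
      also have "\<dots> = 4 * (1 - Z)" by simp
      also have "1 - Z \<le> C5 * (real y powr (1-rho) / ln (real y))"
        unfolding Z_def S_def by (rule C5(2)) fact
      also have "real y powr (1-rho) / ln (real y) \<le> 4 * (Y powr (1 - rho) / ln Y)"
        unfolding y_def by (rule floor_powr_div_ln_le[OF Y])
      finally have Zs: "- ln Z \<le> 4 * (C5 * (4 * (Y powr (1 - rho) / ln Y)))" using C5 by simp
      have "real r * (- ln Z) \<le> (2 * L) * (4 * (C5 * (4 * (Y powr (1 - rho) / ln Y))))"
      proof (rule mult_mono)
        have "Z \<le> 1" unfolding Z_def using finS by (intro sum_powr_rho_le_1) (auto simp: S_def)
        thus "0 \<le> - ln Z" using Z0 by simp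
      qed (use r2 L0 Zs in auto)
      also have "\<dots> = 32 * C5 * (L * Y powr (1 - rho) / ln Y)" by simp
      also have "L * Y powr (1 - rho) = Y"
        using Y unfolding YL[symmetric] by (simp flip: powr_add)
      finally show ?thesis by simp
    qed
    have Plo: "4 * real (card P) + (\<Sum>p\<in>P. ln (2 * (1 + s p))) \<le> (5 + ln (4 * a)) * (C3 * (Y / ln Y))"
    proof -
      have "4 * real (card P) + (\<Sum>p\<in>P. ln (2 * (1 + s p))) = (\<Sum>p\<in>P. 4 + ln (2 * (1 + s p)))"
        by (simp add: sum.distrib)
      also have "\<dots> \<le> (\<Sum>p\<in>P. (5 + ln (4 * a)) * (1 + ln (Y / real p)))"
      proof (rule sum_mono)
        fix p assume p: "p \<in> P"
        have p0: "p > 0" "real p \<le> Y" using p prime_gt_0_nat y by (auto simp: P_def)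
        have l0: "ln (Y / real p) \<ge> 0" using p0 by simp
        have "ln (2 * (1 + s p)) \<le> ln (4 * s p)" using s_ge1[OF p] by (subst ln_le_cancel_iff) auto
        also have "\<dots> = ln (4 * a) + rho / 2 * ln (Y / real p)"
          using a1 p0 Y by (simp add: s_def ln_mult ln_powr)
        also have "rho / 2 * ln (Y / real p) \<le> 1 * ln (Y / real p)"
          using rho_props l0 by (intro mult_right_mono) auto
        finally have "4 + ln (2 * (1 + s p)) \<le> 4 + ln (4 * a) + ln (Y / real p)" by simp
        also have "\<dots> \<le> (5 + ln (4 * a)) * (1 + ln (Y / real p))"
          using lna l0 mult_nonneg_nonneg[OF lna l0] by (simp add: algebra_simps)
        finally show "4 + ln (2 * (1 + s p)) \<le> (5 + ln (4 * a)) * (1 + ln (Y / real p))" .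
      qed
      also have "\<dots> = (5 + ln (4 * a)) * (\<Sum>p\<in>P. 1 + ln (Y / real p))" by (simp add: sum_distrib_left)
      also have "\<dots> \<le> (5 + ln (4 * a)) * (C3 * (Y / ln Y))"
        using C3(2)[of Y] Y lna unfolding P_def y_def by (intro mult_left_mono) auto
      finally show ?thesis .
    qed
    have "rho * (4 * sqrt V + c4) + ln 2 \<le> Y / ln L" using elim by (simp add: V_def Y_def)
    moreover have YY: "Y / ln Y = rho * (Y / ln L)" using lnY by simp
    moreover have "real r * ln Z \<ge> - (32 * C5 * rho * (Y / ln L))"
      using Zlo unfolding YY by (simp only: mult.assoc)
    moreover have "4 * real (card P) + (\<Sum>p\<in>P. ln (2 * (1 + s p))) \<le> (5 + ln (4 * a)) * C3 * rho * (Y / ln L)"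
      using Plo unfolding YY by (simp only: mult.assoc)
    moreover have "C * (Y / ln L) = Y / ln L + 32 * C5 * rho * (Y / ln L) + (5 + ln (4 * a)) * C3 * rho * (Y / ln L)"
      unfolding C_def distrib_right by (simp only: mult_1)
    ultimately have "ln (real (kalmar_K m)) \<ge> rho * L - C * (Y / ln L)"
      using m(3) lo by linarith
    with m(1) up show ?case unfolding Y_def \<alpha>_def by (intro exI[of _ m] conjI)
  qed
  thus ?thesis using \<open>C > 0\<close> by blast
qed

section \<open>Champions\<close>

lemma K_champion_kalmar_K_mono:
  assumes "K_champion N" "0 < m" "m \<le> N"
  shows "kalmar_K m \<le> kalmar_K N"
proof (cases "m = N")
  case False
  hence "kalmar_K m < kalmar_K N" using assms unfolding K_champion_def by simp
  thus ?thesis by simp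
qed simp

lemma K_champion_ln_ge:
  assumes "K_champion N" "0 < m" "m \<le> N"
  shows "ln (real (kalmar_K m)) \<le> ln (real (kalmar_K N))"
proof -
  have "0 < real (kalmar_K m)" "real (kalmar_K m) \<le> real (kalmar_K N)"
    using K_champion_kalmar_K_mono[OF assms] kalmar_K_pos[OF assms(2)] by simp_all
  thus ?thesis by (subst ln_le_cancel_iff) auto
qed

lemma K_champion_large:
  "\<exists>C>0. \<forall>\<^sub>F L in at_top. \<forall>N. K_champion N \<and> ln (real N) = L \<longrightarrow>
     ln (real (kalmar_K N)) \<ge> rho * L - C * (L powr (1 / rho) / ln L)"
proof -
  obtain C where C: "C > 0" "\<forall>\<^sub>F L in at_top. \<exists>m>0. ln (real m) \<le> L \<and>
     ln (real (kalmar_K m)) \<ge> rho * L - C * (L powr (1 / rho) / ln L)"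
    using large_values by blast
  have "\<forall>\<^sub>F L in at_top. \<forall>N. K_champion N \<and> ln (real N) = L \<longrightarrow>
     ln (real (kalmar_K N)) \<ge> rho * L - C * (L powr (1 / rho) / ln L)"
    using C(2)
  proof eventually_elim
    case (elim L)
    show ?case
    proof safe
      fix N assume N: "K_champion N" "L = ln (real N)"
      obtain m where m: "m > 0" "ln (real m) \<le> ln (real N)"
        "ln (real (kalmar_K m)) \<ge> rho * ln (real N) - C * (ln (real N) powr (1 / rho) / ln (ln (real N)))"
        using elim N by blast
      have "m \<le> N" using m N(1) by (simp add: K_champion_def)
      with K_champion_ln_ge[OF N(1) m(1)] m(3)
      show "ln (real (kalmar_K N)) \<ge> rho * ln (real N) - C * (ln (real N) powr (1 / rho) / ln (ln (real N)))"
        by linarith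
    qed
  qed
  thus ?thesis using C(1) by blast
qed

text \<open>
  Compare \<open>K_champion_large\<close> with the bound of \<open>ln_kalmar_K_le_of_prime_divisors\<close> for the prime divisors of
  \<open>N\<close> above \<open>Y\<close>; their sum \<open>E\<close> of \<open>p\<^sup>-\<^sup>\<rho>\<close> satisfies \<open>E L = O(Y / ln L)\<close>.
\<close>
lemma K_champion_omega_upper:
  "\<exists>C>0. \<forall>\<^sub>F L in at_top. \<forall>N. K_champion N \<and> ln (real N) = L \<longrightarrow>
     real (omega N) \<le> C * (L powr (1 / rho) / ln L)"
proof -
  obtain C where C: "C > 0" "\<forall>\<^sub>F L in at_top. \<forall>N. K_champion N \<and> ln (real N) = L \<longrightarrow>
     ln (real (kalmar_K N)) \<ge> rho * L - C * (L powr (1 / rho) / ln L)"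
    using K_champion_large by blast
  obtain C1 where C1: "C1 > 0" "\<And>y P. y \<ge> 2 \<Longrightarrow> finite P \<Longrightarrow> (\<forall>p\<in>P. prime p \<and> y < p) \<Longrightarrow>
           (\<Sum>p\<in>P. real p powr -rho) \<le> C1 * (real y powr (1-rho) / ln (real y))"
    using prime_powr_tail[of rho] rho_props by metis
  obtain C3 where C3: "C3 > 0" "\<And>Y. Y \<ge> 2 \<Longrightarrow>
      (\<Sum>p | prime p \<and> p \<le> nat \<lfloor>Y\<rfloor>. 1 + ln (Y / real p)) \<le> C3 * (Y / ln Y)"
    using prime_ln_quotient_sum by blast
  define K0 where "K0 = C + 2 / ln 2 * (4 * C1 * rho)"
  define C' where "C' = K0 / ln 2 + C3 * rho"
  have "C' > 0" unfolding C'_def K0_def using C C1 C3 rho_props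
    by (intro add_pos_pos mult_pos_pos divide_pos_pos) auto
  have "1 / rho > 0" using rho_props by simp
  hence ev: "\<forall>\<^sub>F L in at_top. L powr (1 / rho) \<ge> 4" by real_asymp
  have "\<forall>\<^sub>F L in at_top. \<forall>N. K_champion N \<and> ln (real N) = L \<longrightarrow>
     real (omega N) \<le> C' * (L powr (1 / rho) / ln L)"
    using C(2) ev eventually_ge_at_top[of "2::real"]
  proof eventually_elim
    case (elim L)
    define Y where "Y = L powr (1 / rho)"
    define y where "y = nat \<lfloor>Y\<rfloor>"
    have Y: "Y \<ge> 4" using elim by (simp add: Y_def)
    have y: "y \<ge> 2" "real y \<le> Y" using floor_bounds[OF Y] by (auto simp: y_def)
    have L0: "L > 0" "ln L > 0" using elim by auto
    have lnY: "ln Y = ln L / rho" using L0 by (simp add: Y_def ln_powr)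
    have YL: "Y powr rho = L" using L0 rho_props by (simp add: Y_def powr_powr)
    have YlnY: "Y / ln Y = rho * (Y / ln L)" using lnY by simp
    show ?case
    proof safe
      fix N assume N: "K_champion N" "L = ln (real N)"
      have N0: "N > 0" using N by (simp add: K_champion_def)
      define P where "P = {p\<in>prime_factors N. y < p}"
      define E where "E = (\<Sum>p\<in>P. real p powr -rho)"
      have finP: "finite P" by (simp add: P_def)
      have "E \<le> C1 * (real y powr (1-rho) / ln (real y))"
        unfolding E_def using y finP by (intro C1) (auto simp: P_def)
      also have "\<dots> \<le> C1 * (4 * (Y powr (1-rho) / ln Y))"
        unfolding y_def using C1 floor_powr_div_ln_le[OF Y] by (intro mult_left_mono) auto
      finally have "E * L \<le> C1 * (4 * (Y powr (1-rho) / ln Y)) * L"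
        using L0 by (intro mult_right_mono) auto
      also have "\<dots> = 4 * C1 * (L * Y powr (1-rho) / ln Y)" by simp
      also have "L * Y powr (1-rho) = Y" using Y unfolding YL[symmetric] by (simp flip: powr_add)
      finally have EL: "E * L \<le> 4 * C1 * rho * (Y / ln L)" unfolding YlnY by simp
      have "rho * L - C * (Y / ln L) \<le> ln (real (kalmar_K N))"
        using elim(1) N by (simp add: Y_def)
      also have "\<dots> \<le> (rho + 2 / ln 2 * E) * ln (real N) - real (card P) * ln 2"
        unfolding E_def using N0 finP
        by (intro ln_kalmar_K_le_of_prime_divisors) (auto simp: P_def)
      also have "\<dots> = rho * L + 2 / ln 2 * (E * L) - real (card P) * ln 2"
        by (simp add: N(2) algebra_simps)
      finally have "real (card P) * ln 2 \<le> C * (Y / ln L) + 2 / ln 2 * (E * L)" by linarith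
      also have "2 / ln 2 * (E * L) \<le> 2 / ln 2 * (4 * C1 * rho * (Y / ln L))"
        using EL by (intro mult_left_mono) auto
      finally have "real (card P) * ln 2 \<le> K0 * (Y / ln L)"
        unfolding K0_def by (simp only: distrib_right mult.assoc)
      hence "real (card P) \<le> K0 * (Y / ln L) / ln 2"
        by (subst le_divide_eq) simp
      hence cP: "real (card P) \<le> K0 / ln 2 * (Y / ln L)"
        by (simp add: mult.commute)
      have cy: "real (card {p. prime p \<and> p \<le> y}) \<le> C3 * rho * (Y / ln L)"
      proof -
        have "real (card {p. prime p \<and> p \<le> y}) = (\<Sum>p | prime p \<and> p \<le> y. 1)" by simp
        also have "\<dots> \<le> (\<Sum>p | prime p \<and> p \<le> y. 1 + ln (Y / real p))"
          using y by (intro sum_mono) (auto dest: prime_gt_0_nat)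
        also have "\<dots> \<le> C3 * (Y / ln Y)" unfolding y_def using Y by (intro C3) auto
        finally show ?thesis unfolding YlnY by simp
      qed
      have "omega N \<le> card (P \<union> {p. prime p \<and> p \<le> y})"
        unfolding omega_def using finP by (intro card_mono) (auto simp: P_def)
      also have "\<dots> \<le> card P + card {p. prime p \<and> p \<le> y}" by (rule card_Un_le)
      finally have "real (omega N) \<le> real (card P) + real (card {p. prime p \<and> p \<le> y})" by linarith
      also have "\<dots> \<le> C' * (Y / ln L)" using cP cy unfolding C'_def distrib_right by linarith
      finally show "real (omega N) \<le> C' * (ln (real N) powr (1 / rho) / ln (ln (real N)))"
        by (simp add: Y_def N(2))
    qed
  qed
  thus ?thesis using \<open>C' > 0\<close> by blast
qed

text \<open>
  If \<open>\<omega>(N) < c a R\<close>, where \<open>R = Y / ln L\<close>, then at least \<open>c a R\<close> primes below \<open>a Y\<close> do not divide \<open>N\<close>. Each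
  has \<open>p\<^sup>-\<^sup>\<rho> \<ge> a\<^sup>-\<^sup>\<rho> / L\<close>, so that \<open>ln K(N)\<close> falls short of \<open>\<rho> L\<close> by \<open>B c a powr (1-\<rho>) R\<close>.
\<close>
lemma K_champion_omega_lower:
  "\<exists>C>0. \<forall>\<^sub>F L in at_top. \<forall>N. K_champion N \<and> ln (real N) = L \<longrightarrow>
     C * (L powr (1 / rho) / ln L) \<le> real (omega N)"
proof -
  obtain C where C: "C > 0" "\<forall>\<^sub>F L in at_top. \<forall>N. K_champion N \<and> ln (real N) = L \<longrightarrow>
     ln (real (kalmar_K N)) \<ge> rho * L - C * (L powr (1 / rho) / ln L)"
    using K_champion_large by blast
  obtain B where B: "B > 0" "\<And>N Q. N > 0 \<Longrightarrow> finite Q \<Longrightarrow> (\<forall>p\<in>Q. prime p \<and> \<not> p dvd N) \<Longrightarrow>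
     ln (real (kalmar_K N)) \<le> (rho - B * (\<Sum>p\<in>Q. real p powr -rho)) * ln (real N)"
    using ln_kalmar_K_le_of_missing_primes by metis
  define c where "c = ln 2 / 12 * rho"
  have c: "c > 0" using rho_props by (simp add: c_def)
  \<comment> \<open>\<open>a\<close> is chosen with \<open>a powr (1 - \<rho>) = D\<close>, which makes the shortfall at least \<open>(C + 1) R\<close>.\<close>
  define D where "D = max 1 ((C + 1) / (B * c))"
  define a where "a = D powr (-1 / (rho - 1))"
  have D: "D \<ge> 1" "B * c * D \<ge> C + 1"
  proof -
    show "D \<ge> 1" by (simp add: D_def)
    have "(C + 1) / (B * c) \<le> D" by (simp add: D_def)
    thus "B * c * D \<ge> C + 1" using B(1) c by (simp add: divide_le_eq mult_ac)
  qed
  have a: "a > 0" "a \<le> 1" "a powr (1 - rho) = D"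
  proof -
    show "a > 0" using D by (simp add: a_def)
    have "a \<le> D powr 0" unfolding a_def using D rho_props by (intro powr_mono) auto
    thus "a \<le> 1" using D by simp
    have "-1 / (rho - 1) * (1 - rho) = 1" using rho_props by (simp add: field_simps)
    thus "a powr (1 - rho) = D" using D by (simp add: a_def powr_powr)
  qed
  have "1 / rho > 0" using rho_props by simp
  hence ev: "\<forall>\<^sub>F L in at_top. a * L powr (1 / rho) \<ge> 4" using a(1) by real_asymp
  have "\<forall>\<^sub>F L in at_top. \<forall>N. K_champion N \<and> ln (real N) = L \<longrightarrow>
     c * a * (L powr (1 / rho) / ln L) \<le> real (omega N)"
    using C(2) ev eventually_ge_at_top[of "2::real"]
  proof eventually_elim
    case (elim L)
    define Y where "Y = L powr (1 / rho)"
    define T where "T = nat \<lfloor>a * Y\<rfloor>"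
    have aY: "a * Y \<ge> 4" using elim by (simp add: Y_def)
    have T: "T \<ge> 2" "real T \<le> a * Y" "a * Y / 2 \<le> real T"
      using floor_bounds[OF aY] by (auto simp: T_def)
    have L0: "L > 0" "ln L > 0" using elim by auto
    have Y0: "Y > 0" using L0 by (simp add: Y_def)
    have lnY: "ln Y = ln L / rho" using L0 by (simp add: Y_def ln_powr)
    have YL: "Y powr rho = L" using L0 rho_props by (simp add: Y_def powr_powr)
    define R where "R = Y / ln L"
    have R0: "R > 0" using Y0 L0 by (simp add: R_def)
    have cT: "real (prime_count T) \<ge> 2 * c * a * R"
    proof -
      have "real T \<le> Y" using T(2) mult_left_le_one_le[of Y a] a Y0 by linarith
      hence "ln (real T) \<le> ln Y" using T(1) Y0 by (subst ln_le_cancel_iff) auto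
      hence "(a * Y / 2) / ln Y \<le> real T / ln (real T)"
        using T by (intro frac_le) auto
      hence "ln 2 / 3 * ((a * Y / 2) / ln Y) \<le> ln 2 / 3 * (real T / ln (real T))"
        by (intro mult_left_mono) auto
      also have "\<dots> \<le> real (prime_count T)" by (rule prime_count_lower[OF T(1)])
      finally show ?thesis unfolding lnY R_def c_def by (simp add: mult_ac)
    qed
    show ?case
    proof safe
      fix N assume N: "K_champion N" "L = ln (real N)"
      have N0: "N > 0" using N by (simp add: K_champion_def)
      have "c * a * R \<le> real (omega N)"
      proof (rule ccontr)
        assume "\<not> ?thesis"
        hence om: "real (omega N) < c * a * R" by simp
        define Q where "Q = {p. prime p \<and> p \<le> T} - prime_factors N"
        have finQ: "finite Q" by (simp add: Q_def)
        have "prime_count T - omega N \<le> card Q"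
          unfolding prime_count_def omega_def Q_def by (rule diff_card_le_card_Diff) auto
        hence "real (card Q) \<ge> real (prime_count T) - real (omega N)" by linarith
        hence cQ: "real (card Q) \<ge> c * a * R" using cT om by simp
        have "(\<Sum>p\<in>Q. real p powr -rho) \<ge> (\<Sum>p\<in>Q. (a * Y) powr -rho)"
        proof (intro sum_mono powr_mono2')
          fix p assume "p \<in> Q"
          hence "prime p" "p \<le> T" by (auto simp: Q_def)
          thus "real p > 0" "real p \<le> a * Y" using T(2) prime_gt_0_nat by (auto intro: order_trans[rotated])
        qed (use rho_props in auto)
        also have "(\<Sum>p\<in>Q. (a * Y) powr -rho) = real (card Q) * (a powr -rho / L)"
          using a Y0 unfolding YL[symmetric] by (simp add: powr_mult powr_minus_divide)
        finally have "real (card Q) * (a powr -rho / L) \<le> (\<Sum>p\<in>Q. real p powr -rho)" .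
        moreover have "c * a * R * (a powr -rho / L) \<le> real (card Q) * (a powr -rho / L)"
          using cQ L0 by (intro mult_right_mono) auto
        ultimately have "c * a * R * (a powr -rho / L) \<le> (\<Sum>p\<in>Q. real p powr -rho)" by linarith
        hence "c * a * R * (a powr -rho / L) * L \<le> (\<Sum>p\<in>Q. real p powr -rho) * L"
          using L0 by (intro mult_right_mono) auto
        moreover have "c * a * R * (a powr -rho / L) * L = c * D * R"
        proof -
          have "a * a powr -rho = D" using a(1) unfolding a(3)[symmetric] by (simp add: powr_diff powr_minus_divide)
          moreover have "c * a * R * (a powr -rho / L) * L = c * (a * a powr -rho) * R" using L0 by simp
          ultimately show ?thesis by simp
        qed
        ultimately have "B * (c * D * R) \<le> B * ((\<Sum>p\<in>Q. real p powr -rho) * L)"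
          using B by (intro mult_left_mono) auto
        moreover have "(C + 1) * R \<le> B * c * D * R" using D R0 by (intro mult_right_mono) auto
        moreover have "rho * L - C * R \<le> ln (real (kalmar_K N))"
          using elim(1) N by (simp add: R_def Y_def)
        moreover have "ln (real (kalmar_K N)) \<le> (rho - B * (\<Sum>p\<in>Q. real p powr -rho)) * ln (real N)"
          using N0 finQ by (intro B) (auto simp: Q_def in_prime_factors_iff)
        moreover have "(rho - B * (\<Sum>p\<in>Q. real p powr -rho)) * ln (real N)
            = rho * L - B * ((\<Sum>p\<in>Q. real p powr -rho) * L)"
          by (simp add: N(2) algebra_simps)
        moreover have "(C + 1) * R = C * R + R" "B * c * D * R = B * (c * D * R)"
          by (simp_all add: algebra_simps)
        ultimately show False using R0 by linarith
      qed
      thus "c * a * (ln (real N) powr (1 / rho) / ln (ln (real N))) \<le> real (omega N)"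
        by (simp add: R_def Y_def N(2))
    qed
  qed
  moreover have "c * a > 0" using c a by simp
  ultimately show ?thesis by blast
qed

text \<open>
  The first part uses of a champion only that \<open>K(m) \<le> K(N)\<close> for \<open>m \<le> N\<close>.
\<close>
theorem mainTheorem2:
  shows "(\<forall>C6::real. 0 < C6 \<longrightarrow>
            (\<forall>\<^sub>F n::nat in sequentially. \<exists>m::nat. 0 < m \<and> m \<le> n \<and>
               ln (real (kalmar_K m))
                 \<ge> rho * ln (real n) - C6 * (ln (real n) powr (1 / rho) / ln (ln (real n))) \<and>
               rho * ln (real n) - C6 * (ln (real n) powr (1 / rho) / ln (ln (real n)))
                 \<ge> rho * ln (real m) - C6 * (ln (real m) powr (1 / rho) / ln (ln (real m)))) \<longrightarrow>
            (\<forall>\<^sub>F N::nat in sequentially. K_champion N \<longrightarrow>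
               ln (real (kalmar_K N))
                 \<ge> rho * ln (real N) - C6 * (ln (real N) powr (1 / rho) / ln (ln (real N)))))
       \<and> (\<exists>C7 C8 N0 :: real. 0 < C7 \<and> 0 < C8 \<and> 0 < N0 \<and>
            (\<forall>N::nat. K_champion N \<and> N0 \<le> real N \<longrightarrow>
               C7 * (ln (real N) powr (1 / rho) / ln (ln (real N))) \<le> real (omega N) \<and>
               real (omega N) \<le> C8 * (ln (real N) powr (1 / rho) / ln (ln (real N)))))"
proof (intro conjI allI impI)
  fix C6 :: real
  assume "\<forall>\<^sub>F n::nat in sequentially. \<exists>m::nat. 0 < m \<and> m \<le> n \<and>
               ln (real (kalmar_K m))
                 \<ge> rho * ln (real n) - C6 * (ln (real n) powr (1 / rho) / ln (ln (real n))) \<and>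
               rho * ln (real n) - C6 * (ln (real n) powr (1 / rho) / ln (ln (real n)))
                 \<ge> rho * ln (real m) - C6 * (ln (real m) powr (1 / rho) / ln (ln (real m)))"
  thus "\<forall>\<^sub>F N::nat in sequentially. K_champion N \<longrightarrow>
               ln (real (kalmar_K N))
                 \<ge> rho * ln (real N) - C6 * (ln (real N) powr (1 / rho) / ln (ln (real N)))"
  proof eventually_elim
    case (elim n)
    then obtain m where m: "0 < m" "m \<le> n" "ln (real (kalmar_K m))
                 \<ge> rho * ln (real n) - C6 * (ln (real n) powr (1 / rho) / ln (ln (real n)))" by blast
    show ?case using K_champion_ln_ge[OF _ m(1,2)] m(3) by (auto intro: order_trans)
  qed
next
  obtain C7 where C7: "C7 > 0" "\<forall>\<^sub>F L in at_top. \<forall>N. K_champion N \<and> ln (real N) = L \<longrightarrow>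
     C7 * (L powr (1 / rho) / ln L) \<le> real (omega N)"
    using K_champion_omega_lower by blast
  obtain C8 where C8: "C8 > 0" "\<forall>\<^sub>F L in at_top. \<forall>N. K_champion N \<and> ln (real N) = L \<longrightarrow>
     real (omega N) \<le> C8 * (L powr (1 / rho) / ln L)"
    using K_champion_omega_upper by blast
  obtain L0 where L0: "\<And>L N. L \<ge> L0 \<Longrightarrow> K_champion N \<Longrightarrow> ln (real N) = L \<Longrightarrow>
      C7 * (L powr (1 / rho) / ln L) \<le> real (omega N) \<and> real (omega N) \<le> C8 * (L powr (1 / rho) / ln L)"
    using eventually_conj[OF C7(2) C8(2)] unfolding eventually_at_top_linorder by blast
  have key: "\<forall>N::nat. K_champion N \<and> exp L0 \<le> real N \<longrightarrow>
               C7 * (ln (real N) powr (1 / rho) / ln (ln (real N))) \<le> real (omega N) \<and>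
               real (omega N) \<le> C8 * (ln (real N) powr (1 / rho) / ln (ln (real N)))"
  proof (intro allI impI, elim conjE)
    fix N :: nat assume N: "K_champion N" "exp L0 \<le> real N"
    hence "L0 \<le> ln (real N)" by (simp add: K_champion_def ln_ge_iff)
    thus "C7 * (ln (real N) powr (1 / rho) / ln (ln (real N))) \<le> real (omega N) \<and>
      real (omega N) \<le> C8 * (ln (real N) powr (1 / rho) / ln (ln (real N)))"
      by (rule L0[OF _ N(1) refl])
  qed
  show "\<exists>C7 C8 N0 :: real. 0 < C7 \<and> 0 < C8 \<and> 0 < N0 \<and>
            (\<forall>N::nat. K_champion N \<and> N0 \<le> real N \<longrightarrow>
               C7 * (ln (real N) powr (1 / rho) / ln (ln (real N))) \<le> real (omega N) \<and>
               real (omega N) \<le> C8 * (ln (real N) powr (1 / rho) / ln (ln (real N))))"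
    by (rule exI[of _ C7], rule exI[of _ C8], rule exI[of _ "exp L0"],
        intro conjI C7(1) C8(1) exp_gt_zero key)
qed

end
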